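(* Assume the uniform $q$-variant of the Hardy--Littlewood prime $k$-tuple conjecture (stated in the context). Let $k \geq 0$ be a fixed integer. Suppose $q=q(N)$ satisfies $\varphi(q)=(1+o(1))\frac{N}{\lambda \log N}$ as $N\to\infty$ for some fixed $\lambda>0$. Then $$\lim_{N \to \infty} \frac{1}{\varphi(q)}\left| \left\{ a \bmod q : (a,q)=1,\ \pi(N;q,a)=k \right\} \right| =e^{-\lambda}\frac{\lambda^k}{k!}.$$
   Context: $\varphi$ is Euler's totient function, $\Lambda$ is the von Mangoldt function, $1_{\mathbb{P}}$ is the indicator function of the primes, and $\pi(N;q,a)$ is the number of primes $p\leq N$ with $p\equiv a \ (\mathrm{mod}\ q)$. For a finite set $\mathcal{D}$ of $k$ distinct integers and $q\geq 1$, let $v_p(\mathcal{D})$ be the number of residue classes modulo $p$ occupied by $\mathcal{D}$, and define $$\mathfrak{S}(\mathcal{D};q) := \left( \frac{\varphi(q)}{q} \right)^{-k} \prod_{p \nmid q} \left( 1-\frac{1}{p} \right)^{-k}\left( 1-\frac{v_p(\mathcal{D})}{p} \right).$$ Conjecture (uniform $q$-variant of the Hardy--Littlewood prime $k$-tuple conjecture): there is an absolute constant $0<\delta<1/2$ such that, for all integers $k,q,D,N\geq 1$ with $\varphi(q) \leq N/\log N$ and $D \leq N$, every set $\mathcal{D} \subseteq [1,D]$ consisting of $k$ distinct multiples of $q$, and every $1 \leq x \leq N$, $$\sum_{\substack{1 \leq n \leq x\\ (n,q)=1}} \prod_{d \in \mathcal{D}}\Lambda(n+d)= \mathfrak{S}(\mathcal{D};q)\,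 \left| \{ 1 \leq n \leq x : (n,q)=1 \} \right|+O_{k,\delta}(N^{1-\delta}),$$ or equivalently (by partial summation) $$\sum_{\substack{1 \leq n \leq x\\(n,q)=1}} \prod_{d \in \mathcal{D}}1_{\mathbb{P}}(n+d) = \mathfrak{S}(\mathcal{D};q) \sum_{\substack{1 \leq n \leq x\\(n,q)=1}} \left( \prod_{d \in \mathcal{D}} \log (n+d) \right)^{-1} +O_{k,\delta}(N^{1-\delta}).$$ *)

theory Defs
  imports
    "HOL-Analysis.Infinite_Products"
    "HOL-Number_Theory.Number_Theory"
    "HOL-Library.Landau_Symbols"
begin

definition primes_in_ap :: "nat \<Rightarrow> nat \<Rightarrow> nat \<Rightarrow> nat" where
  "primes_in_ap N q a = card {p. prime p \<and> p \<le> N \<and> [p = a] (mod q)}"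

definition residue_classes_occupied :: "nat \<Rightarrow> nat set \<Rightarrow> nat" where
  "residue_classes_occupied p \<D> = card ((\<lambda>d. d mod p) ` \<D>)"

(* The infinite product runs over all naturals p in increasing order, with factor 1 unless p is
   a prime not dividing q.  Finitely many factors may vanish (when the set occupies every class
   mod p); has_prod, and hence prodinf, then yields the value 0, as it should. *)
definition singular_series :: "nat set \<Rightarrow> nat \<Rightarrow> real" where
  "singular_series \<D> q =
     1 / (real (totient q) / real q) ^ card \<D> *
     (\<Prod>p. if prime p \<and> \<not> p dvd q
          then 1 / (1 - 1 / real p) ^ card \<D> *
               (1 - real (residue_classes_occupied p \<D>) / real p)
          else 1)"

definition coprimes_upto :: "nat \<Rightarrow> real \<Rightarrow> nat set" where
  "coprimes_upto q x = {n. 1 \<le> n \<and> real n \<le> x \<and> coprime n q}"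

(* The exponent delta is absolute, while the implied constant C may depend on k (and delta) but
   is uniform in all remaining parameters.  For N = 1 we have N / ln N = 0 in HOL, so that case,
   where the original bound on totient q is undefined, imposes no condition; it would concern
   only q = 1 and the set {1}, which a constant C absorbs. *)
definition uniform_hardy_littlewood :: bool where
  "uniform_hardy_littlewood \<longleftrightarrow>
     (\<exists>\<delta>::real. 0 < \<delta> \<and> \<delta> < 1 / 2 \<and>
       (\<forall>k\<ge>1. \<exists>C::real. \<forall>q\<ge>1. \<forall>D\<ge>1. \<forall>N\<ge>1. \<forall>\<D>::nat set. \<forall>x::real.
          real (totient q) \<le> real N / ln (real N) \<longrightarrow> D \<le> N \<longrightarrow>
          \<D> \<subseteq> {1..D} \<longrightarrow> card \<D> = k \<longrightarrow> (\<forall>d\<in>\<D>. q dvd d) \<longrightarrow>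
          1 \<le> x \<longrightarrow> x \<le> real N \<longrightarrow>
          \<bar>(\<Sum>n\<in>coprimes_upto q x. \<Prod>d\<in>\<D>. mangoldt (n + d))
             - singular_series \<D> q * real (card (coprimes_upto q x))\<bar>
            \<le> C * real N powr (1 - \<delta>)))"

end

(* Write X a for the number of primes a + q * e with 1 <= e <= H, where H is about N / q and a runs
   over the reduced residues modulo q. The m-th factorial moment of X is a sum, over the m-element
   sets E of {1..H}, of counts of n <= q with all n + q * e prime, and the conjecture evaluates each
   count by the singular series of q * E. As H tends to infinity (because q / totient q = o(log q)),
   these singular series have average value (q / totient q) ^ m, uniformly in q, by Gallagher's
   theorem: primes above (log H) / 8 change no single singular series by more than a factor 1 + o(1),
   while the average over E of the product over the smaller primes can be computed almost exactly.
   Hence the m-th factorial moment tends to lam ^ m, and Bonferroni's inequalities give the Poisson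
   limit. Residue classes with a prime at either end of the range, which X misses, are rare: the
   conjecture with modulus 1 bounds the number of primes in intervals of length q. *)
theory Submission
  imports Defs "HOL-Real_Asymp.Real_Asymp"
begin

section \<open>Elementary prime estimates\<close>

text \<open>Taking x = q in the conjecture lets n run over exactly one reduced residue system, so
  the counting factor is \<open>totient q\<close>; for shifts that are multiples of q, the primes
  dividing q contribute precisely \<open>(q / totient q) ^ m\<close>. Thus a + q * e behaves like a
  prime with probability \<open>q / (totient q * ln N)\<close>, and H times this tends to lam. The
  index e = 0 is left out because the conjecture admits only positive shifts, the last incomplete
  block because there a + q * e exceeds N for some a only. How fast H grows depends on
  \<open>q / totient q\<close>, so the average over E has to work for every H tending to infinity
  and for all q at once. This fixes the truncation point: the product of the primes up to y is
  bounded by exp (2 * y), which must stay below H, so y is taken as a small multiple of ln H (any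
  factor strictly between 0 and 1/2 would serve in place of 1/8). On the other side H is at most of
  order ln N, so summing the error N powr (1 - delta) over at most H ^ m sets E costs only powers of
  ln N.\<close>

lemma prod_distinct_primes_dvd:
  fixes n :: nat
  assumes "finite A" "\<And>p. p \<in> A \<Longrightarrow> prime p" "\<And>p. p \<in> A \<Longrightarrow> p dvd n"
  shows "\<Prod>A dvd n"
  using assms
proof (induction A rule: finite_induct)
  case (insert p A)
  have "coprime p (\<Prod>A)"
    by (intro prod_coprime_right) (metis insert.hyps(2) insert.prems(1) insertI1 insertI2 primes_coprime)
  thus ?case using insert by (simp add: divides_mult)
qed auto

text \<open>Every prime in the range divides (2 * m + 1)! but neither m! nor (m + 1)!, hence it
  divides the binomial coefficient. That coefficient is one term of the lower half of its row, and
  the lower half sums to 4 ^ m.\<close>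

lemma prod_primes_interval_le:
  "(\<Prod>p | prime p \<and> m + 1 < p \<and> p \<le> 2 * m + 1. p) \<le> (4::nat) ^ m"
proof -
  let ?A = "{p. prime p \<and> m + 1 < p \<and> p \<le> 2 * m + 1}"
  have "p dvd (2 * m + 1 choose m)" if p: "p \<in> ?A" for p
  proof -
    have "p dvd (fact (2 * m + 1) :: nat)" using p prime_dvd_fact_iff[of p "2 * m + 1"] by blast
    also have "fact (2 * m + 1) = fact m * fact (m + 1) * (2 * m + 1 choose m)"
      using binomial_fact_lemma[of m "2 * m + 1"] by simp
    finally have "p dvd fact m * fact (m + 1) * (2 * m + 1 choose m)" .
    moreover have "prime p" using p by simp
    moreover have "\<not> p dvd fact m" "\<not> p dvd fact (m + 1)"
      using p by (simp_all only: prime_dvd_fact_iff mem_Collect_eq) linarith+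
    ultimately show ?thesis by (simp only: prime_dvd_mult_iff) blast
  qed
  hence "\<Prod>?A dvd (2 * m + 1 choose m)"
    by (intro prod_distinct_primes_dvd) auto
  hence "\<Prod>?A \<le> (2 * m + 1 choose m)" by (intro dvd_imp_le) auto
  also have "\<dots> \<le> (\<Sum>k\<le>m. (2 * m + 1 choose k))"
    by (rule member_le_sum) auto
  also have "\<dots> = 4 ^ m" by (simp only: binomial_r_part_sum power_mult) simp
  finally show ?thesis .
qed

text \<open>Erdos's induction: an even n > 2 is not prime, and for n = 2 * m + 1 the primes are
  split at m + 1. The bound later controls the period \<Prod>Q of the divisibility conditions at
  small primes.\<close>

lemma prod_primes_le_4_power: "(\<Prod>p | prime p \<and> p \<le> n. p) \<le> (4::nat) ^ n"
proof (induction n rule: less_induct)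
  case (less n)
  consider "n \<le> 1" | "n = 2" | "n > 2" "even n" | m where "m \<ge> 1" "n = 2 * m + 1"
  proof (cases "even n")
    case False
    then obtain m where "n = 2 * m + 1" by (rule oddE)
    thus ?thesis using that(1) that(4)[of m] by (cases "m \<ge> 1") auto
  qed (use that in linarith)
  then show ?case
  proof cases
    case 1
    have "{p. prime p \<and> p \<le> n} = {}"
      using 1 by (auto dest: prime_gt_1_nat)
    thus ?thesis by (simp only: prod.empty) simp
  next
    case 2
    have "{p. prime p \<and> p \<le> n} = {2}"
      using 2 by (auto dest: prime_ge_2_nat)
    thus ?thesis by (simp add: 2)
  next
    case 3
    have "prime p \<and> p \<le> n \<longleftrightarrow> prime p \<and> p \<le> n - 1" for p
      using prime_odd_nat[of p] 3 by (cases "p = n") auto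
    hence "{p. prime p \<and> p \<le> n} = {p. prime p \<and> p \<le> n - 1}"
      by simp
    hence "(\<Prod>p | prime p \<and> p \<le> n. p) = (\<Prod>p | prime p \<and> p \<le> n - 1. p)" by simp
    also have "\<dots> \<le> 4 ^ (n - 1)" using less.IH[of "n - 1"] 3 by simp
    also have "\<dots> \<le> 4 ^ n" by (intro power_increasing) auto
    finally show ?thesis .
  next
    case 4
    have "{p. prime p \<and> p \<le> n} = {p. prime p \<and> p \<le> m + 1} \<union> {p. prime p \<and> m + 1 < p \<and> p \<le> 2 * m + 1}"
      using 4 by auto
    hence "(\<Prod>p | prime p \<and> p \<le> n. p) =
        (\<Prod>p | prime p \<and> p \<le> m + 1. p) * (\<Prod>p | prime p \<and> m + 1 < p \<and> p \<le> 2 * m + 1. p)"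
      by (simp only:) (rule prod.union_disjoint, auto)
    also have "\<dots> \<le> 4 ^ (m + 1) * 4 ^ m"
      using less.IH[of "m + 1"] 4 prod_primes_interval_le[of m] by (intro mult_mono) auto
    also have "\<dots> = 4 ^ n" using 4 by (simp flip: power_add)
    finally show ?thesis .
  qed
qed

text \<open>The worst case is the set of the first r odd numbers from 3 on, where the product
  telescopes to 2 * r + 1. The induction removes the largest element, which is at least 2 * r + 3
  when r others remain.\<close>

lemma prod_odd_le:
  fixes S :: "nat set"
  assumes "finite S" "\<And>p. p \<in> S \<Longrightarrow> odd p \<and> p \<ge> 3"
  shows "(\<Prod>p\<in>S. real p / (real p - 2)) \<le> 2 * real (card S) + 1"
  using assms
proof (induction "card S" arbitrary: S)
  case (Suc r)
  let ?m = "Max S"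
  have ne: "S \<noteq> {}" using Suc by auto
  have m: "?m \<in> S" using ne Suc.prems by auto
  have card: "card (S - {?m}) = r" using m Suc by simp
  \<comment> \<open>Distinct odd numbers have distinct halves \<open>p div 2\<close>, all positive,
    so \<open>card S\<close> is at most \<open>Max S div 2\<close>.\<close>
  have "inj_on (\<lambda>p. p div 2) S"
    by (intro inj_onI) (metis Suc.prems(2) odd_two_times_div_two_succ)
  moreover have "(\<lambda>p. p div 2) ` S \<subseteq> {1..?m div 2}"
    using Suc.prems by (force intro!: div_le_mono)
  ultimately have "card S \<le> ?m div 2"
    using card_inj_on_le[of "\<lambda>p. p div 2" S "{1..?m div 2}"] by simp
  hence ge: "real ?m \<ge> 2 * real r + 3"
    using Suc.prems(2)[OF m] Suc.hyps(2) by (elim conjE oddE) auto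
  have "(\<Prod>p\<in>S. real p / (real p - 2)) = real ?m / (real ?m - 2) * (\<Prod>p\<in>S - {?m}. real p / (real p - 2))"
    using m Suc.prems by (simp add: prod.remove)
  also have "\<dots> \<le> real ?m / (real ?m - 2) * (2 * real r + 1)"
    using Suc.hyps(1)[of "S - {?m}"] card Suc.prems ge by (intro mult_left_mono) auto
  also have "\<dots> \<le> 2 * real r + 3"
    using ge by (simp add: field_simps)
  finally show ?case using Suc.hyps(2)[symmetric] by simp
qed auto

text \<open>Squaring makes the odd Euler factors comparable with telescoping quotients:
  \<open>(p / (p - 1))\<^sup>2 \<le> p / (p - 2)\<close>, to which the bound for distinct odd
  numbers applies. The leading 4 is the squared factor of p = 2.\<close>

lemma square_totient_ratio_le:
  assumes "n > 0"
  shows "(real n / real (totient n))\<^sup>2 \<le> 4 * (2 * real (card (prime_factors n)) + 1)"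
proof -
  let ?P = "prime_factors n"
  let ?S = "?P - {2}"
  have odd: "odd p \<and> p \<ge> 3" if "p \<in> ?S" for p
  proof -
    have "prime p" "p \<noteq> 2" using that by auto
    moreover from this have "p > 2" using prime_ge_2_nat[of p] by simp
    ultimately show ?thesis using prime_odd_nat[of p] by auto
  qed
  have "real n / real (totient n) = (\<Prod>p\<in>?P. 1 / (1 - 1 / real p))"
    using assms by (simp add: totient_formula2 prod_dividef)
  also have "\<dots> = (\<Prod>p\<in>?P. real p / (real p - 1))"
  proof (rule prod.cong)
    fix p assume "p \<in> ?P"
    hence "p > 1" using prime_gt_1_nat by auto
    thus "1 / (1 - 1 / real p) = real p / (real p - 1)" by (simp add: field_simps)
  qed simp
  finally have "(real n / real (totient n))\<^sup>2 = (\<Prod>p\<in>?P. (real p / (real p - 1))\<^sup>2)"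
    by (simp add: prod_power_distrib)
  also have "\<dots> = (\<Prod>p\<in>?P \<inter> {2}. (real p / (real p - 1))\<^sup>2) * (\<Prod>p\<in>?S. (real p / (real p - 1))\<^sup>2)"
    by (subst prod.union_disjoint [symmetric]) (auto intro!: prod.cong)
  also have "\<dots> \<le> 4 * (\<Prod>p\<in>?S. real p / (real p - 2))"
  proof (rule mult_mono)
    show "(\<Prod>p\<in>?P \<inter> {2}. (real p / (real p - 1))\<^sup>2) \<le> 4"
      by (cases "2 \<in> ?P") auto
    show "(\<Prod>p\<in>?S. (real p / (real p - 1))\<^sup>2) \<le> (\<Prod>p\<in>?S. real p / (real p - 2))"
    proof (rule prod_mono, intro conjI)
      fix p assume "p \<in> ?S"
      hence "p \<ge> 3" using odd by blast
      hence "real p * (real p - 2) \<le> (real p - 1)\<^sup>2" "real p > 2"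
        by (auto simp: power2_eq_square algebra_simps)
      hence "real p * (real p * (real p - 2)) \<le> real p * (real p - 1)\<^sup>2"
        by (intro mult_left_mono) auto
      thus "(real p / (real p - 1))\<^sup>2 \<le> real p / (real p - 2)"
        using \<open>real p > 2\<close> by (simp add: divide_simps power2_eq_square mult_ac)
    qed auto
  qed (auto intro!: prod_nonneg)
  also have "\<dots> \<le> 4 * (2 * real (card ?S) + 1)"
    using prod_odd_le[of ?S] odd by auto
  also have "\<dots> \<le> 4 * (2 * real (card ?P) + 1)"
    by (simp add: card_mono)
  finally show ?thesis .
qed

lemma card_prime_factors_le_ln:
  assumes "n > 0"
  shows "real (card (prime_factors n)) \<le> 2 * ln (real n)"
proof -
  have "2 ^ card (prime_factors n) \<le> \<Prod>(prime_factors n)"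
    using prod_mono[of "prime_factors n" "\<lambda>_. 2::nat" "\<lambda>p. p"]
    by (auto simp: in_prime_factors_iff prime_ge_2_nat)
  also have "\<dots> \<le> n"
    by (intro dvd_imp_le prod_distinct_primes_dvd) (use assms in auto)
  finally have "real (2 ^ card (prime_factors n)) \<le> real n" by linarith
  hence "ln (2 ^ card (prime_factors n)) \<le> ln (real n)"
    using assms by (intro ln_mono) auto
  hence "real (card (prime_factors n)) * ln 2 \<le> ln (real n)" by (simp add: ln_realpow)
  moreover have "real (card (prime_factors n)) * (1 / 2) \<le> real (card (prime_factors n)) * ln 2"
    using ln_le_minus_one[of "1 / 2"] by (intro mult_left_mono) (auto simp: ln_div)
  ultimately show ?thesis by linarith
qed

text \<open>The true order of \<open>n / totient n\<close> is \<open>ln (ln n)\<close>; a square root saving over the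
  trivial bound \<open>ln n\<close> is all that is needed.\<close>
lemma eventually_le_totient_ln:
  fixes \<epsilon> :: real
  assumes "\<epsilon> > 0"
  shows "eventually (\<lambda>n. real n \<le> \<epsilon> * real (totient n) * ln (real n)) sequentially"
proof -
  have "eventually (\<lambda>n. sqrt (16 * ln (real n) + 4) \<le> \<epsilon> * ln (real n)) sequentially"
    using assms by real_asymp
  thus ?thesis using eventually_gt_at_top[of 0]
  proof eventually_elim
    case (elim n)
    have "(real n / real (totient n))\<^sup>2 \<le> 16 * ln (real n) + 4"
      using square_totient_ratio_le[of n] card_prime_factors_le_ln[of n] elim by simp
    hence "real n / real (totient n) \<le> sqrt (16 * ln (real n) + 4)"
      by (rule real_le_rsqrt)
    also have "\<dots> \<le> \<epsilon> * ln (real n)" by (rule elim)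
    finally show ?case using elim by (simp add: field_simps)
  qed
qed

section \<open>Counting a periodic predicate on an interval\<close>

lemma card_periodic_interval:
  fixes P :: "nat \<Rightarrow> bool"
  assumes "\<And>n. P (n + W) \<longleftrightarrow> P n"
  shows "card {n\<in>{a..<a + W}. P n} = card {n. n < W \<and> P n}"
proof (induction a)
  case (Suc a)
  show ?case
  proof (cases "W = 0")
    case False
    let ?C = "{n\<in>{Suc a..<a + W}. P n}"
    have "{n\<in>{a..<a + W}. P n} = (if P a then insert a ?C else ?C)"
      using False by (auto simp: le_eq_less_or_eq)
    moreover have "{n\<in>{Suc a..<Suc a + W}. P n} = (if P (a + W) then insert (a + W) ?C else ?C)"
      using False by (auto simp: less_Suc_eq)
    ultimately have "card {n\<in>{Suc a..<Suc a + W}. P n} = card {n\<in>{a..<a + W}. P n}"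
      using assms[of a] by auto
    thus ?thesis using Suc by simp
  qed auto
qed (auto intro: arg_cong[where f = card])

lemma card_periodic_multiple:
  fixes P :: "nat \<Rightarrow> bool"
  assumes "\<And>n. P (n + W) \<longleftrightarrow> P n"
  shows "card {n\<in>{a..<a + t * W}. P n} = t * card {n. n < W \<and> P n}"
proof (induction t)
  case (Suc t)
  have "{n\<in>{a..<a + Suc t * W}. P n} =
      {n\<in>{a..<a + t * W}. P n} \<union> {n\<in>{a + t * W..<a + t * W + W}. P n}"
    by auto
  hence "card {n\<in>{a..<a + Suc t * W}. P n} =
      card {n\<in>{a..<a + t * W}. P n} + card {n\<in>{a + t * W..<a + t * W + W}. P n}"
    by (simp only:) (rule card_Un_disjoint, force+)
  thus ?case using Suc card_periodic_interval[of P W, OF assms] by simp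
qed auto

text \<open>H lies between t and t + 1 full periods, where t = \<open>H div W\<close>. The error is
  one period's count c and not W, so it can be absorbed into the main term H * c / W by moving H by
  W.\<close>

lemma card_periodic_approx:
  fixes P :: "nat \<Rightarrow> bool"
  assumes per: "\<And>n. P (n + W) \<longleftrightarrow> P n" and W: "W > 0"
  defines "c \<equiv> card {n. n < W \<and> P n}"
  shows "\<bar>real (card {n\<in>{a..<a + H}. P n}) - real H * real c / real W\<bar> \<le> real c"
proof -
  let ?t = "H div W"
  have H: "?t * W \<le> H" "H \<le> Suc ?t * W"
    using div_mult_mod_eq[of H W] mod_less_divisor[OF W, of H] by (simp, unfold mult_Suc, linarith)
  have "?t * c \<le> card {n\<in>{a..<a + H}. P n}"
    unfolding c_def card_periodic_multiple[of P W, OF per, of a, symmetric]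
    by (rule card_mono, simp) (use H(1) in \<open>force intro: order.strict_trans2\<close>)
  hence 1: "real ?t * real c \<le> real (card {n\<in>{a..<a + H}. P n})"
    by (simp flip: of_nat_mult)
  have "card {n\<in>{a..<a + H}. P n} \<le> Suc ?t * c"
    unfolding c_def card_periodic_multiple[of P W, OF per, of a, symmetric]
    by (rule card_mono, simp, use H(2) in \<open>auto simp del: mult_Suc\<close>)
  hence 2: "real (card {n\<in>{a..<a + H}. P n}) \<le> (real ?t + 1) * real c"
    by (metis of_nat_le_iff of_nat_mult of_nat_Suc add.commute)
  have "real ?t * real W \<le> real H" using H(1) by (simp flip: of_nat_mult)
  hence "real ?t * real W * real c \<le> real H * real c" by (intro mult_right_mono) auto
  hence 3: "real ?t * real c \<le> real H * real c / real W"
    using W by (simp add: field_simps)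
  have "real H \<le> (real ?t + 1) * real W"
    using H(2) by (metis of_nat_le_iff of_nat_mult of_nat_Suc add.commute)
  hence "real H * real c \<le> (real ?t + 1) * real W * real c" by (intro mult_right_mono) auto
  hence 4: "real H * real c / real W \<le> (real ?t + 1) * real c"
    using W by (simp add: field_simps)
  show ?thesis using 1 2 3 4 by (simp add: algebra_simps abs_le_iff)
qed

section \<open>Residues avoiding zero modulo a set of primes\<close>

text \<open>The Chinese remainder theorem as a bijection onto \<open>PiE Q S\<close>;
  \<open>restrict\<close> fixes the values outside Q, so that a tuple of residues is a genuine
  element of \<open>PiE\<close>.\<close>

lemma card_less_prod_primes_mod:
  fixes Q :: "nat set"
  assumes Q: "finite Q" "\<And>p. p \<in> Q \<Longrightarrow> prime p"
    and S: "\<And>p. p \<in> Q \<Longrightarrow> S p \<subseteq> {..<p}"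
  shows "card {n. n < \<Prod>Q \<and> (\<forall>p\<in>Q. n mod p \<in> S p)} = (\<Prod>p\<in>Q. card (S p))"
proof -
  let ?f = "\<lambda>n. restrict (\<lambda>p. n mod p) Q"
  let ?A = "{n. n < \<Prod>Q \<and> (\<forall>p\<in>Q. n mod p \<in> S p)}"
  have cop: "\<forall>i\<in>Q. \<forall>j\<in>Q. i \<noteq> j \<longrightarrow> coprime i j"
    using Q(2) primes_coprime by blast
  have nz: "\<forall>i\<in>Q. i \<noteq> 0" using Q(2) by (metis not_prime_0)
  have ex: "\<exists>!x. x < \<Prod>Q \<and> (\<forall>p\<in>Q. [x = u p] (mod p))" for u
    using chinese_remainder_unique_nat[OF Q(1), of "\<lambda>p. p" u] nz cop by blast
  have "bij_betw ?f ?A (PiE Q S)"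
  proof (rule bij_betwI')
    fix x y assume x: "x \<in> ?A" and y: "y \<in> ?A"
    show "?f x = ?f y \<longleftrightarrow> x = y"
    proof
      assume eq: "?f x = ?f y"
      have "x mod p = y mod p" if "p \<in> Q" for p
        using fun_cong[OF eq, of p] that by simp
      hence "\<forall>p\<in>Q. [x = y] (mod p)" by (simp add: unique_euclidean_semiring_class.cong_def)
      moreover have "\<forall>p\<in>Q. [y = y] (mod p)" by simp
      ultimately show "x = y" using ex[of "\<lambda>_. y"] x y by blast
    qed auto
  next
    fix x assume "x \<in> ?A"
    thus "?f x \<in> PiE Q S" by auto
  next
    fix u assume u: "u \<in> PiE Q S"
    obtain x where x: "x < \<Prod>Q" "\<forall>p\<in>Q. [x = u p] (mod p)" using ex[of u] by blast
    have mod: "x mod p = u p" if "p \<in> Q" for p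
    proof -
      have "u p < p" using PiE_mem[OF u that] S[OF that] by auto
      thus ?thesis using x(2) that by (simp add: unique_euclidean_semiring_class.cong_def)
    qed
    have "x \<in> ?A" using x(1) mod u by auto
    moreover have "u = ?f x" using mod u by (auto simp: fun_eq_iff PiE_def extensional_def)
    ultimately show "\<exists>x\<in>?A. u = ?f x" by blast
  qed
  hence "card ?A = card (PiE Q S)" by (rule bij_betw_same_card)
  thus ?thesis using Q(1) by (simp add: card_PiE)
qed

lemma residue_classes_occupied_le:
  assumes "p > 0"
  shows "residue_classes_occupied p E \<le> p"
proof -
  have "(\<lambda>d. d mod p) ` E \<subseteq> {..<p}" using assms by auto
  thus ?thesis unfolding residue_classes_occupied_def using card_mono[of "{..<p}"] by simp
qed

text \<open>The excluded residues are the negatives of those occupied by E. Negation modulo p is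
  \<open>(p - x) mod p\<close>, where the outer \<open>mod\<close> sends x = 0 to 0, and it is
  injective on the residues.\<close>

lemma card_residues_avoiding:
  assumes p: "p > 0"
  shows "card {r. r < p \<and> (\<forall>e\<in>E. \<not> p dvd r + e)} = p - residue_classes_occupied p E"
proof -
  let ?g = "\<lambda>x. (p - x) mod p"
  let ?B = "{r. r < p \<and> (\<exists>e\<in>E. p dvd r + e)}"
  have img: "?B = ?g ` (\<lambda>e. e mod p) ` E"
  proof (intro equalityI subsetI)
    fix r assume "r \<in> ?B"
    then obtain e where e: "r < p" "e \<in> E" "p dvd r + e" by auto
    have "(r + e mod p) mod p = 0" using e(3) by (simp add: mod_add_right_eq)
    moreover have "e mod p < p" using p by simp
    ultimately have "r = (p - e mod p) mod p" using e(1) p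
    proof (cases "e mod p = 0")
      case False
      have "p dvd r + e mod p" using \<open>(r + e mod p) mod p = 0\<close> by auto
      then obtain k where k: "r + e mod p = p * k" by (elim dvdE)
      have "0 < p * k" "p * k < p * 2" using k e(1) \<open>e mod p < p\<close> False by linarith+
      hence "k = 1" by simp
      thus ?thesis using k False e(1) p by simp
    qed auto
    thus "r \<in> ?g ` (\<lambda>e. e mod p) ` E" using e(2) by blast
  next
    fix r assume "r \<in> ?g ` (\<lambda>e. e mod p) ` E"
    then obtain e where e: "e \<in> E" "r = (p - e mod p) mod p" by auto
    have "(r + e) mod p = ((p - e mod p) + e mod p) mod p" unfolding e(2) by presburger
    also have "\<dots> = 0" using p by (simp add: less_imp_le)
    finally show "r \<in> ?B" using e p by auto
  qed
  have "inj_on ?g {..<p}"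
  proof (rule inj_onI)
    fix x y assume "x \<in> {..<p}" "y \<in> {..<p}" "?g x = ?g y"
    thus "x = y" by (cases "x = 0"; cases "y = 0") auto
  qed
  hence "inj_on ?g ((\<lambda>e. e mod p) ` E)"
    by (rule inj_on_subset) (use p in auto)
  hence cardB: "card ?B = residue_classes_occupied p E"
    unfolding img residue_classes_occupied_def by (rule card_image)
  have "{r. r < p \<and> (\<forall>e\<in>E. \<not> p dvd r + e)} = {..<p} - ?B" by auto
  also have "card \<dots> = p - card ?B" by (subst card_Diff_subset) auto
  finally show ?thesis by (simp only: cardB)
qed

lemma card_less_prod_primes_avoiding:
  fixes Q :: "nat set"
  assumes Q: "finite Q" "\<And>p. p \<in> Q \<Longrightarrow> prime p"
  shows "card {n. n < \<Prod>Q \<and> (\<forall>p\<in>Q. \<forall>e\<in>E. \<not> p dvd n + e)} =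
    (\<Prod>p\<in>Q. p - residue_classes_occupied p E)"
proof -
  let ?S = "\<lambda>p. {r. r < p \<and> (\<forall>e\<in>E. \<not> p dvd r + e)}"
  have "p dvd n + e \<longleftrightarrow> p dvd n mod p + e" for p n e :: nat
    by (simp add: dvd_eq_mod_eq_0 mod_add_left_eq)
  hence "(\<forall>p\<in>Q. \<forall>e\<in>E. \<not> p dvd n + e) \<longleftrightarrow> (\<forall>p\<in>Q. n mod p \<in> ?S p)" for n
    using prime_gt_0_nat[OF Q(2)] by auto
  hence "card {n. n < \<Prod>Q \<and> (\<forall>p\<in>Q. \<forall>e\<in>E. \<not> p dvd n + e)} =
      card {n. n < \<Prod>Q \<and> (\<forall>p\<in>Q. n mod p \<in> ?S p)}" by simp
  also have "\<dots> = (\<Prod>p\<in>Q. card (?S p))"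
    by (rule card_less_prod_primes_mod) (use Q in auto)
  also have "\<dots> = (\<Prod>p\<in>Q. p - residue_classes_occupied p E)"
    by (intro prod.cong card_residues_avoiding refl) (use Q prime_gt_0_nat in auto)
  finally show ?thesis .
qed

section \<open>Binomial coefficients and Bonferroni's inequality\<close>

lemma binomial_le_power_div_fact: "real (A choose m) \<le> real A ^ m / fact m"
proof -
  have "real ((A choose m) * fact m) \<le> real (A ^ m)"
    using binomial_fact_pow[of A m] by (subst of_nat_le_iff)
  thus ?thesis by (simp add: field_simps)
qed

lemma binomial_ge_power_div_fact:
  assumes "0 \<le> x" "x \<le> real A - real m"
  shows "x ^ m / fact m \<le> real (A choose m)"
proof -
  have "x ^ m = (\<Prod>i = 0..<m. x)" by simp
  also have "\<dots> \<le> (\<Prod>i = 0..<m. real A - real i)"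
    by (rule prod_mono) (use assms in auto)
  also have "\<dots> = fact m * (real A gchoose m)" by (rule gbinomial_mult_fact [symmetric])
  also have "\<dots> = fact m * real (A choose m)" by (simp add: binomial_gbinomial)
  finally show ?thesis by (simp add: field_simps)
qed

text \<open>Since \<open>(k + j choose k) * (X choose (k + j)) = (X choose k) * (X - k choose
  j)\<close>, the sum is a truncated alternating row sum, with value
  \<open>(X choose k) * (-1) ^ J * (X - k - 1 choose J)\<close>. For X > k this is at most the first
  omitted term in absolute value.\<close>

lemma binomial_inversion_bound:
  fixes X k J :: nat
  shows "\<bar>(if X = k then 1 else 0) - (\<Sum>j\<le>J. (-1) ^ j * real (k + j choose k) * real (X choose (k + j)))\<bar>
    \<le> real (k + Suc J choose k) * real (X choose (k + Suc J))"
proof (cases "k \<le> X")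
  case False
  thus ?thesis by (auto simp: binomial_eq_0)
next
  case True
  have rev: "real (k + j choose k) * real (X choose (k + j)) = real (X choose k) * real (X - k choose j)" for j
  proof (cases "k + j \<le> X")
    case True
    thus ?thesis using choose_mult[of k "k + j" X] by (simp flip: of_nat_mult add: mult.commute)
  next
    case False
    thus ?thesis using \<open>k \<le> X\<close> by (simp add: binomial_eq_0)
  qed
  have "(\<Sum>j\<le>J. (-1) ^ j * real (k + j choose k) * real (X choose (k + j))) =
      real (X choose k) * (\<Sum>j\<le>J. (real (X - k) gchoose j) * (-1) ^ j)"
    unfolding mult.assoc rev by (simp add: sum_distrib_left binomial_gbinomial [symmetric] mult_ac)
  also have "\<dots> = real (X choose k) * ((-1) ^ J * (real (X - k) - 1 gchoose J))"
    by (simp only: gbinomial_sum_lower_neg)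
  finally have sum: "(\<Sum>j\<le>J. (-1) ^ j * real (k + j choose k) * real (X choose (k + j))) =
      real (X choose k) * ((-1) ^ J * (real (X - k) - 1 gchoose J))" .
  show ?thesis
  proof (cases "X = k")
    case True
    \<comment> \<open>For X = k the upper index X - k - 1 is -1, hence the generalised binomial
      coefficient: the truncated sum is then exactly 1.\<close>
    have "(-1 :: real) gchoose J = (-1) ^ J"
      using gbinomial_minus[of "1::real" J] by (simp add: binomial_gbinomial [symmetric] flip: of_nat_add)
    thus ?thesis using True sum by (simp flip: power_mult_distrib)
  next
    case False
    then obtain Y where Y: "X - k = Suc Y" using \<open>k \<le> X\<close> by (metis Suc_diff_Suc le_neq_implies_less)
    have "\<bar>(if X = k then 1 else 0) - (\<Sum>j\<le>J. (-1) ^ j * real (k + j choose k) * real (X choose (k + j)))\<bar>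
        = real (X choose k) * real (Y choose J)"
      using False Y unfolding sum by (simp add: abs_mult binomial_gbinomial [symmetric])
    also have "\<dots> \<le> real (X choose k) * real (X - k choose Suc J)"
      by (intro mult_left_mono) (simp_all add: Y)
    also have "\<dots> = real (k + Suc J choose k) * real (X choose (k + Suc J))" by (rule rev [symmetric])
    finally show ?thesis .
  qed
qed

section \<open>Local densities averaged over all sets E\<close>

definition local_factor :: "nat set \<Rightarrow> nat \<Rightarrow> real" where
  "local_factor E p = 1 / (1 - 1 / real p) ^ card E * (1 - real (residue_classes_occupied p E) / real p)"

text \<open>The product of local densities is the proportion of \<open>n\<close> modulo \<open>\<Prod>Q\<close> with every \<open>n + e\<close>
  coprime to \<open>\<Prod>Q\<close>. Interchanging the sums over \<open>E\<close> and \<open>n\<close> leaves a binomial coefficient.\<close>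
lemma sum_local_densities_eq:
  fixes Q :: "nat set"
  assumes Q: "finite Q" "\<And>p. p \<in> Q \<Longrightarrow> prime p"
  shows "(\<Sum>E | E \<subseteq> {1..H} \<and> card E = m. \<Prod>p\<in>Q. 1 - real (residue_classes_occupied p E) / real p) =
    (\<Sum>n<\<Prod>Q. real (card {e\<in>{1..H}. \<forall>p\<in>Q. \<not> p dvd n + e} choose m)) / real (\<Prod>Q)"
proof -
  let ?W = "\<Prod>Q" and ?ES = "{E. E \<subseteq> {1..H} \<and> card E = m}"
  have pos: "p > 0" if "p \<in> Q" for p using Q(2)[OF that] prime_gt_0_nat by blast
  have dens: "(\<Prod>p\<in>Q. 1 - real (residue_classes_occupied p E) / real p) =
      real (card {n. n < ?W \<and> (\<forall>p\<in>Q. \<forall>e\<in>E. \<not> p dvd n + e)}) / real ?W" for E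
  proof -
    have "(\<Prod>p\<in>Q. 1 - real (residue_classes_occupied p E) / real p) =
        (\<Prod>p\<in>Q. real (p - residue_classes_occupied p E) / real p)"
      by (intro prod.cong refl) (use pos residue_classes_occupied_le in \<open>auto simp: field_simps of_nat_diff\<close>)
    thus ?thesis
      by (simp add: card_less_prod_primes_avoiding[OF Q] prod_dividef of_nat_prod)
  qed
  have fin: "finite ?ES" by (rule finite_subset[of _ "Pow {1..H}"]) auto
  have "(\<Sum>E\<in>?ES. card {n. n < ?W \<and> (\<forall>p\<in>Q. \<forall>e\<in>E. \<not> p dvd n + e)}) =
      (\<Sum>E\<in>?ES. \<Sum>n<?W. if \<forall>p\<in>Q. \<forall>e\<in>E. \<not> p dvd n + e then 1 else 0)"
    by (intro sum.cong refl) (simp add: sum.If_cases Int_def lessThan_def Collect_conj_eq [symmetric])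
  also have "\<dots> = (\<Sum>n<?W. \<Sum>E\<in>?ES. if \<forall>p\<in>Q. \<forall>e\<in>E. \<not> p dvd n + e then 1 else 0)"
    by (rule sum.swap)
  also have "\<dots> = (\<Sum>n<?W. card {e\<in>{1..H}. \<forall>p\<in>Q. \<not> p dvd n + e} choose m)"
  proof (rule sum.cong)
    fix n
    have "(\<Sum>E\<in>?ES. if \<forall>p\<in>Q. \<forall>e\<in>E. \<not> p dvd n + e then 1 else (0::nat)) =
        card (?ES \<inter> {E. \<forall>p\<in>Q. \<forall>e\<in>E. \<not> p dvd n + e})"
      using fin by (simp add: sum.If_cases)
    also have "?ES \<inter> {E. \<forall>p\<in>Q. \<forall>e\<in>E. \<not> p dvd n + e} =
        {E. E \<subseteq> {e\<in>{1..H}. \<forall>p\<in>Q. \<not> p dvd n + e} \<and> card E = m}"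
      by blast
    also have "card \<dots> = card {e\<in>{1..H}. \<forall>p\<in>Q. \<not> p dvd n + e} choose m"
      by (rule n_subsets) auto
    finally show "(\<Sum>E\<in>?ES. if \<forall>p\<in>Q. \<forall>e\<in>E. \<not> p dvd n + e then 1 else (0::nat)) = \<dots>" .
  qed simp
  finally show ?thesis
    unfolding dens sum_divide_distrib [symmetric] by (simp flip: of_nat_sum)
qed

text \<open>\<open>local_factor\<close> is the local density at p divided by its value
  \<open>(1 - 1 / p) ^ m\<close> under independence. With W = \<Prod>Q and c units modulo W, these
  normalisations multiply to (W / c) ^ m, while a window of length H holds about H * c / W integers
  coprime to W and so about (H * c / W) ^ m / m! of the relevant m-sets. The powers of c / W cancel,
  which leaves bounds in H and W alone.\<close>

lemma sum_prod_local_factor_bounds: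
  fixes Q :: "nat set" and H m :: nat
  assumes Q: "finite Q" "\<And>p. p \<in> Q \<Longrightarrow> prime p"
  defines "G \<equiv> (\<Sum>E | E \<subseteq> {1..H} \<and> card E = m. \<Prod>p\<in>Q. local_factor E p)"
  shows "G \<le> (real H + real (\<Prod>Q)) ^ m / fact m"
    and "real H \<ge> (real m + 1) * real (\<Prod>Q) \<Longrightarrow>
      (real H - (real m + 1) * real (\<Prod>Q)) ^ m / fact m \<le> G"
proof -
  let ?W = "\<Prod>Q" and ?ES = "{E. E \<subseteq> {1..H} \<and> card E = m}"
  let ?A = "\<lambda>n. {e\<in>{1..H}. \<forall>p\<in>Q. \<not> p dvd n + e}"
  define c where "c = (\<Prod>p\<in>Q. p - 1)"
  have gt1: "p > 1" if "p \<in> Q" for p using Q(2)[OF that] prime_gt_1_nat by blast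
  have W: "?W > 0" using gt1 by (intro prod_pos) force
  have c: "c > 0" unfolding c_def using gt1 by (intro prod_pos) force
  have "c \<le> ?W" unfolding c_def by (intro prod_mono) auto
  have ratio: "(\<Prod>p\<in>Q. 1 - 1 / real p) = real c / real ?W"
  proof -
    have "(\<Prod>p\<in>Q. 1 - 1 / real p) = (\<Prod>p\<in>Q. real (p - 1) / real p)"
    proof (rule prod.cong)
      fix p assume "p \<in> Q"
      thus "1 - 1 / real p = real (p - 1) / real p"
        using gt1[of p] by (simp add: field_simps of_nat_diff)
    qed simp
    thus ?thesis by (simp add: c_def prod_dividef of_nat_prod)
  qed
  have G: "G = (real ?W / real c) ^ m * ((\<Sum>n<?W. real (card (?A n) choose m)) / real ?W)"
  proof -
    have "(\<Prod>p\<in>Q. local_factor E p) = (real ?W / real c) ^ m *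
        (\<Prod>p\<in>Q. 1 - real (residue_classes_occupied p E) / real p)" if "E \<in> ?ES" for E
    proof -
      have "(\<Prod>p\<in>Q. local_factor E p) = (\<Prod>p\<in>Q. 1 / (1 - 1 / real p) ^ m) *
        (\<Prod>p\<in>Q. 1 - real (residue_classes_occupied p E) / real p)"
        using that by (simp add: local_factor_def flip: prod.distrib)
      also have "(\<Prod>p\<in>Q. 1 / (1 - 1 / real p) ^ m) = (real ?W / real c) ^ m"
        by (simp add: prod_dividef prod_power_distrib [symmetric] ratio power_divide)
      finally show ?thesis .
    qed
    hence "G = (\<Sum>E\<in>?ES. (real ?W / real c) ^ m *
        (\<Prod>p\<in>Q. 1 - real (residue_classes_occupied p E) / real p))"
      unfolding G_def by (intro sum.cong) auto
    thus ?thesis by (simp only: sum_distrib_left [symmetric] sum_local_densities_eq[OF Q])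
  qed
  have cardA: "\<bar>real (card (?A n)) - real H * real c / real ?W\<bar> \<le> real c" for n
  proof -
    let ?P = "\<lambda>i. \<forall>p\<in>Q. \<not> p dvd i"
    have per: "?P (i + ?W) \<longleftrightarrow> ?P i" for i
    proof -
      have "p dvd ?W" if "p \<in> Q" for p using that Q(1) by (simp add: dvd_prod_eqI)
      thus ?thesis by (auto simp: dvd_add_left_iff)
    qed
    \<comment> \<open>Avoidance with the set {0} means that no p in Q divides n, which leaves p - 1
      classes for each p.\<close>
    have c': "card {i. i < ?W \<and> ?P i} = c"
      using card_less_prod_primes_avoiding[OF Q, of "{0}"]
      by (simp add: c_def residue_classes_occupied_def)
    have "?A n = (\<lambda>i. i - n) ` {i\<in>{n + 1..<n + 1 + H}. ?P i}"
    proof (intro equalityI subsetI)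
      fix e assume "e \<in> ?A n"
      thus "e \<in> (\<lambda>i. i - n) ` {i\<in>{n + 1..<n + 1 + H}. ?P i}"
        by (intro image_eqI[of _ _ "n + e"]) auto
    qed auto
    moreover have "inj_on (\<lambda>i. i - n) {i\<in>{n + 1..<n + 1 + H}. ?P i}"
      by (auto simp: inj_on_def)
    ultimately have "card (?A n) = card {i\<in>{n + 1..<n + 1 + H}. ?P i}"
      by (simp add: card_image)
    thus ?thesis using card_periodic_approx[of ?P ?W "n + 1" H, OF per W] by (simp only: c')
  qed
  have W': "real ?W > 0" and c1: "real c \<ge> 1" using W c by linarith+
  have up: "real (card (?A n)) \<le> real c / real ?W * (real H + real ?W)" for n
    using cardA[of n] W' by (simp add: field_simps abs_le_iff)
  \<comment> \<open>Of the m + 1 multiples of W, one covers the counting error c; the other m become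
    \<open>m * c \<ge> m\<close>, the shift that \<open>binomial_ge_power_div_fact\<close>
    demands.\<close>
  have lo: "real c / real ?W * (real H - (real m + 1) * real ?W) \<le> real (card (?A n)) - real m" for n
  proof -
    have "real c / real ?W * (real H - (real m + 1) * real ?W) =
        real H * real c / real ?W - real c - real m * real c"
      using W' by (simp add: field_simps)
    moreover have "real m * 1 \<le> real m * real c" using c1 by (intro mult_left_mono) auto
    ultimately show ?thesis using cardA[of n] by (simp add: abs_le_iff)
  qed
  have "(\<Sum>n<?W. real (card (?A n) choose m)) \<le>
      (\<Sum>n<?W. (real c / real ?W * (real H + real ?W)) ^ m / fact m)"
    by (intro sum_mono order.trans[OF binomial_le_power_div_fact] divide_right_mono power_mono up) auto
  also have "\<dots> = real ?W * ((real c / real ?W * (real H + real ?W)) ^ m / fact m)" by simp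
  finally have "G \<le> (real ?W / real c) ^ m * ((real c / real ?W * (real H + real ?W)) ^ m / fact m)"
    unfolding G using W' by (intro mult_left_mono) (simp_all add: field_simps)
  also have "\<dots> = (real H + real ?W) ^ m / fact m"
    using W' c1 by (simp add: power_divide power_mult_distrib)
  finally show "G \<le> (real H + real ?W) ^ m / fact m" .
  assume H: "real H \<ge> (real m + 1) * real ?W"
  have "(real H - (real m + 1) * real ?W) ^ m / fact m =
      (real ?W / real c) ^ m * ((real c / real ?W * (real H - (real m + 1) * real ?W)) ^ m / fact m)"
    using W' c1 by (simp add: power_divide power_mult_distrib)
  also have "\<dots> \<le> G"
  proof -
    have "0 \<le> real c / real ?W * (real H - (real m + 1) * real ?W)"
      by (intro mult_nonneg_nonneg divide_nonneg_nonneg of_nat_0_le_iff) (use H in linarith)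
    hence "(\<Sum>n<?W. (real c / real ?W * (real H - (real m + 1) * real ?W)) ^ m / fact m)
        \<le> (\<Sum>n<?W. real (card (?A n) choose m))"
      by (intro sum_mono binomial_ge_power_div_fact lo)
    hence "real ?W * ((real c / real ?W * (real H - (real m + 1) * real ?W)) ^ m / fact m)
        \<le> (\<Sum>n<?W. real (card (?A n) choose m))" by simp
    thus ?thesis unfolding G using W' by (intro mult_left_mono) (simp_all add: field_simps)
  qed
  finally show "(real H - (real m + 1) * real ?W) ^ m / fact m \<le> G" .
qed

section \<open>Gallagher's average of the singular series\<close>

lemma residue_classes_occupied_le_card:
  "finite E \<Longrightarrow> residue_classes_occupied p E \<le> card E"
  unfolding residue_classes_occupied_def by (rule card_image_le)

lemma local_factor_nonneg:
  assumes "p > 0"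
  shows "local_factor E p \<ge> 0"
proof -
  have "real (residue_classes_occupied p E) / real p \<le> 1"
    using residue_classes_occupied_le[OF assms, of E] assms by simp
  thus ?thesis using assms unfolding local_factor_def by (intro mult_nonneg_nonneg) auto
qed

text \<open>\<open>1 - m\<^sup>2 / p\<^sup>2\<close> factors as (1 + m / p) * (1 - m / p);
  Bernoulli's inequality handles the first factor, and the second holds because at most m classes
  are occupied. The linear terms in 1 / p cancel, so the total loss over all p > y is only of order
  1 / y.\<close>

lemma local_factor_ge:
  assumes "finite E" "p > 1" "card E \<le> p"
  shows "local_factor E p \<ge> 1 - (real (card E))\<^sup>2 / (real p)\<^sup>2"
proof -
  let ?m = "real (card E)" and ?p = "real p"
  have "1 - ?m\<^sup>2 / ?p\<^sup>2 = (1 + ?m * (1 / ?p)) * (1 - ?m / ?p)"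
    by (simp add: algebra_simps power2_eq_square)
  also have "\<dots> \<le> (1 / (1 - 1 / ?p)) ^ card E * (1 - real (residue_classes_occupied p E) / ?p)"
  proof (rule mult_mono)
    have "-1 \<le> 1 / ?p" by (rule order.trans[of _ 0]) auto
    hence "1 + ?m * (1 / ?p) \<le> (1 + 1 / ?p) ^ card E"
      by (rule Bernoulli_inequality)
    also have "\<dots> \<le> (1 / (1 - 1 / ?p)) ^ card E"
      using assms by (intro power_mono) (auto simp: field_simps)
    finally show "1 + ?m * (1 / ?p) \<le> (1 / (1 - 1 / ?p)) ^ card E" .
    show "1 - ?m / ?p \<le> 1 - real (residue_classes_occupied p E) / ?p"
      using residue_classes_occupied_le_card[OF assms(1), of p] by (simp add: divide_right_mono)
    show "0 \<le> (1 / (1 - 1 / ?p)) ^ card E" using assms by simp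
    show "0 \<le> 1 - ?m / ?p" using assms by simp
  qed
  finally show ?thesis by (simp add: local_factor_def power_divide)
qed

text \<open>Bernoulli gives \<open>(1 - 1 / p) ^ m \<ge> 1 - m / p\<close>. Hence only primes modulo
  which two elements of E collide can push the singular series up.\<close>

lemma local_factor_le_1:
  assumes "p > 1" "residue_classes_occupied p E = card E"
  shows "local_factor E p \<le> 1"
proof -
  have "1 + real (card E) * (- (1 / real p)) \<le> (1 + - (1 / real p)) ^ card E"
    by (rule Bernoulli_inequality) (use assms in auto)
  moreover have "(1 - 1 / real p) ^ card E > 0" using assms by simp
  ultimately show ?thesis using assms by (simp add: local_factor_def)
qed

text \<open>Used at the primes where elements of E collide; these are so few that the crude bound
  \<open>1 / (1 - 1 / p) \<le> 1 + 2 / p\<close> suffices.\<close>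

lemma local_factor_le_exp:
  assumes "p > 1"
  shows "local_factor E p \<le> exp (2 * real (card E) / real p)"
proof -
  have "1 / (1 - 1 / real p) \<le> 1 + 2 / real p"
    using assms by (simp add: field_simps)
  also have "\<dots> \<le> exp (2 / real p)" by (rule exp_ge_add_one_self)
  finally have "(1 / (1 - 1 / real p)) ^ card E \<le> exp (2 / real p) ^ card E"
    using assms by (intro power_mono) auto
  also have "\<dots> = exp (2 * real (card E) / real p)"
    by (simp flip: exp_of_nat_mult add: mult_ac)
  finally have "1 / (1 - 1 / real p) ^ card E \<le> exp (2 * real (card E) / real p)"
    by (simp add: power_divide)
  moreover have "local_factor E p \<le> 1 / (1 - 1 / real p) ^ card E * 1"
    unfolding local_factor_def using assms by (intro mult_left_mono) auto
  ultimately show ?thesis by simp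
qed

lemma residue_collision:
  assumes "finite E" "residue_classes_occupied p E < card E"
  obtains e e' where "e \<in> E" "e' \<in> E" "e < e'" "p dvd e' - e"
proof -
  have "\<not> inj_on (\<lambda>d. d mod p) E"
    using assms card_image unfolding residue_classes_occupied_def by fastforce
  then obtain a b where ab: "a \<in> E" "b \<in> E" "a \<noteq> b" "a mod p = b mod p"
    by (auto simp: inj_on_def)
  show ?thesis
  proof (cases "a < b")
    case True
    thus ?thesis using that[of a b] ab by (metis less_imp_le mod_eq_dvd_iff_nat)
  next
    case False
    thus ?thesis using that[of b a] ab by (metis less_imp_le linorder_neqE_nat mod_eq_dvd_iff_nat)
  qed
qed

text \<open>The primes in \<open>B\<close> all divide the product of the differences of elements of \<open>E\<close>.\<close>
lemma card_collision_primes_le: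
  fixes y :: real
  assumes E: "E \<subseteq> {1..H}" and y: "y > 1" and B: "finite B"
    "\<And>p. p \<in> B \<Longrightarrow> prime p \<and> real p > y \<and> residue_classes_occupied p E < card E"
    and H: "H \<ge> 1"
  shows "real (card B) * ln y \<le> (real (card E))\<^sup>2 * ln (real H)"
proof -
  have fin: "finite E" using E finite_subset by blast
  define T where "T = {(e, e'). e \<in> E \<and> e' \<in> E \<and> e < e'}"
  have T: "T \<subseteq> E \<times> E" unfolding T_def by auto
  have finT: "finite T" using T fin by (meson finite_SigmaI finite_subset)
  define \<Delta> where "\<Delta> = (\<Prod>(e, e')\<in>T. e' - e)"
  have pos: "\<Delta> > 0" unfolding \<Delta>_def T_def by (intro prod_pos) auto
  have "\<Delta> \<le> (\<Prod>t\<in>T. H)"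
    unfolding \<Delta>_def by (rule prod_mono) (use T E in \<open>force simp: T_def\<close>)
  also have "\<dots> = H ^ card T" by simp
  also have "\<dots> \<le> H ^ (card E * card E)"
    using card_mono[OF _ T] fin H by (intro power_increasing) (auto simp: card_cartesian_product)
  finally have \<Delta>: "\<Delta> \<le> H ^ (card E * card E)" .
  have "\<Prod>B dvd \<Delta>"
  proof (rule prod_distinct_primes_dvd)
    fix p assume "p \<in> B"
    then obtain e e' where e: "e \<in> E" "e' \<in> E" "e < e'" "p dvd e' - e"
      using residue_collision[OF fin] B(2) by metis
    hence "(e, e') \<in> T" by (simp add: T_def)
    hence "e' - e dvd \<Delta>" unfolding \<Delta>_def using finT by (metis (no_types, lifting) case_prod_conv dvd_prodI)
    thus "p dvd \<Delta>" using e(4) by (rule dvd_trans[rotated])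
  qed (use B in auto)
  hence "\<Prod>B \<le> H ^ (card E * card E)" using pos \<Delta> dvd_imp_le order.trans by blast
  hence "real (\<Prod>B) \<le> real (H ^ (card E * card E))" by (subst of_nat_le_iff)
  hence le: "real (\<Prod>B) \<le> real H ^ (card E * card E)" by (simp only: of_nat_power)
  have "y ^ card B = (\<Prod>p\<in>B. y)" by simp
  also have "\<dots> \<le> (\<Prod>p\<in>B. real p)"
    by (rule prod_mono) (use B(2) y in force)
  also have "\<dots> \<le> real H ^ (card E * card E)" using le by simp
  finally have "ln (y ^ card B) \<le> ln (real H ^ (card E * card E))"
    using y by (intro ln_mono) auto
  thus ?thesis using y H by (simp add: ln_realpow power2_eq_square)
qed

text \<open>All integers above y may be summed, because
  \<open>1 / p\<^sup>2 \<le> 2 / (p * (p + 1))\<close> and the right side telescopes. The start a is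
  the first integer above y, so that 2 / a is below 2 / y.\<close>

lemma sum_inverse_squares_le:
  fixes y :: real
  assumes "y > 0" "finite T" "\<And>p. p \<in> T \<Longrightarrow> real p > y"
  shows "(\<Sum>p\<in>T. 1 / (real p)\<^sup>2) \<le> 2 / y"
proof -
  define a where "a = nat \<lfloor>y\<rfloor> + 1"
  have a: "real a > y" "a > 0" unfolding a_def using assms(1) by linarith+
  have aT: "a \<le> p" if "p \<in> T" for p
    using assms(3)[OF that] assms(1) unfolding a_def by linarith
  obtain b where b: "T \<subseteq> {..<b}" using assms(2) finite_nat_iff_bounded by blast
  have tel: "(\<Sum>p\<in>{a..<c}. 2 / (real p * (real p + 1))) = 2 / real a - 2 / real c" if "a \<le> c" for c
    using that
  proof (induction c rule: dec_induct)
    case (step c)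
    have "real c > 0" using step a by simp
    hence "2 / (real c * (real c + 1)) = 2 / real c - 2 / real (Suc c)"
      by (simp add: field_simps)
    thus ?case using step by simp
  qed simp
  have "(\<Sum>p\<in>T. 1 / (real p)\<^sup>2) \<le> (\<Sum>p\<in>{a..<max a b}. 1 / (real p)\<^sup>2)"
    using aT b by (intro sum_mono2) force+
  also have "\<dots> \<le> (\<Sum>p\<in>{a..<max a b}. 2 / (real p * (real p + 1)))"
  proof (rule sum_mono)
    fix p assume "p \<in> {a..<max a b}"
    hence "real p \<ge> 1" using a by auto
    moreover from this have "real p * (real p + 1) \<le> 2 * (real p)\<^sup>2"
      by (simp add: power2_eq_square algebra_simps mult_left_mono)
    ultimately have "2 / (2 * (real p)\<^sup>2) \<le> 2 / (real p * (real p + 1))"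
      by (intro divide_left_mono mult_pos_pos) auto
    thus "1 / (real p)\<^sup>2 \<le> 2 / (real p * (real p + 1))" by simp
  qed
  also have "\<dots> = 2 / real a - 2 / real (max a b)" by (rule tel) simp
  also have "\<dots> \<le> 2 / real a" by simp
  also have "\<dots> \<le> 2 / y" using a assms(1) by (intro divide_left_mono) auto
  finally show ?thesis .
qed

text \<open>For p not dividing q, multiplication by q permutes the classes modulo p, so these are
  also the Euler factors of the set of multiples q * e. The power of \<open>q / totient q\<close> is
  split off because it depends only on the size of E.\<close>

definition sing_prod :: "nat set \<Rightarrow> nat \<Rightarrow> real" where
  "sing_prod E q = (\<Prod>p. if prime p \<and> \<not> p dvd q then local_factor E p else 1)"

text \<open>For p > H no difference of two elements of E is divisible by p, so with m = card E and p
  \<ge> m the factor lies between \<open>1 - m\<^sup>2 / p\<^sup>2\<close> and 1, and the product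
  converges absolutely.\<close>

lemma sing_prod_LIMSEQ:
  assumes E: "E \<subseteq> {1..H}"
  shows "(\<lambda>n. \<Prod>p\<le>n. if prime p \<and> \<not> p dvd q then local_factor E p else 1) \<longlonglongrightarrow> sing_prod E q"
proof -
  let ?f = "\<lambda>p. if prime p \<and> \<not> p dvd q then local_factor E p else 1"
  have fin: "finite E" using E finite_subset by blast
  have "eventually (\<lambda>p. norm (norm (?f p - 1)) \<le> (real (card E))\<^sup>2 * (1 / (real p)\<^sup>2)) sequentially"
    using eventually_gt_at_top[of "H + card E"]
  proof eventually_elim
    case (elim p)
    show ?case
    proof (cases "prime p")
      case True
      hence p1: "p > 1" by (rule prime_gt_1_nat)
      have "\<not> residue_classes_occupied p E < card E"
      proof
        assume "residue_classes_occupied p E < card E"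
        then obtain e e' where e: "e \<in> E" "e' \<in> E" "e < e'" "p dvd e' - e"
          by (rule residue_collision[OF fin])
        hence "p \<le> e' - e" by (intro dvd_imp_le) auto
        thus False using e E elim by fastforce
      qed
      hence "residue_classes_occupied p E = card E"
        using residue_classes_occupied_le_card[OF fin, of p] by linarith
      hence "local_factor E p \<le> 1" by (rule local_factor_le_1[OF p1])
      moreover have "local_factor E p \<ge> 1 - (real (card E))\<^sup>2 / (real p)\<^sup>2"
        by (rule local_factor_ge[OF fin p1]) (use elim in simp)
      ultimately show ?thesis by simp
    qed simp
  qed
  moreover have "summable (\<lambda>p. (real (card E))\<^sup>2 * (1 / (real p)\<^sup>2))"
    using inverse_power_summable[of 2, where ?'a = real] by (intro summable_mult) (simp add: inverse_eq_divide)
  ultimately have "summable (\<lambda>p. norm (?f p - 1))"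
    by (rule summable_comparison_test_ev)
  hence "convergent_prod ?f"
    using abs_convergent_prod_conv_summable abs_convergent_prod_imp_convergent_prod by blast
  thus ?thesis unfolding sing_prod_def by (rule convergent_prod_LIMSEQ)
qed

text \<open>Both bounds are proved for the finite product over y < p \<le> n, uniformly in n, before
  n tends to infinity. From below, Weierstrass's product inequality turns the losses
  \<open>m\<^sup>2 / p\<^sup>2\<close> into a sum. From above only collision primes count: there are
  at most \<open>m\<^sup>2 * ln H / ln y\<close> of them, each with a factor of at most exp (2 * m /
  y).\<close>

lemma sing_prod_truncation:
  fixes y :: real and q :: nat
  assumes E: "E \<subseteq> {1..H}" "card E = m" and y: "y > 1" "y \<ge> real m" and H: "H \<ge> 1"
  defines "P \<equiv> (\<Prod>p | prime p \<and> real p \<le> y \<and> \<not> p dvd q. local_factor E p)"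
  shows "P * (1 - 2 * (real m)\<^sup>2 / y) \<le> sing_prod E q"
    and "sing_prod E q \<le> P * exp (2 * real m ^ 3 * ln (real H) / (y * ln y))"
proof -
  let ?f = "\<lambda>p. if prime p \<and> \<not> p dvd q then local_factor E p else 1"
  let ?C = "exp (2 * real m ^ 3 * ln (real H) / (y * ln y))"
  have fin: "finite E" using E finite_subset by blast
  have P: "P \<ge> 0" unfolding P_def by (intro prod_nonneg) (auto intro!: local_factor_nonneg prime_gt_0_nat)
  have bounds: "(\<Prod>p\<le>n. ?f p) \<in> {P * (1 - 2 * (real m)\<^sup>2 / y)..P * ?C}" if n: "real n \<ge> y" for n
  proof -
    define T where "T = {p. prime p \<and> p \<le> n \<and> real p > y \<and> \<not> p dvd q}"
    define B where "B = {p\<in>T. residue_classes_occupied p E < card E}"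
    have finT: "finite T" unfolding T_def by simp
    have BT: "B \<subseteq> T" "finite B" using finT unfolding B_def by auto
    have Tp: "prime p" "p > 1" "real p > y" "p \<ge> m" if "p \<in> T" for p
      using that y prime_gt_1_nat[of p] unfolding T_def by auto
    define A where "A = {p. prime p \<and> real p \<le> y \<and> \<not> p dvd q}"
    have AT: "{p. p \<le> n \<and> prime p \<and> \<not> p dvd q} = A \<union> T" "A \<inter> T = {}"
      using n unfolding A_def T_def by auto
    have "finite A" unfolding A_def by (rule finite_subset[of _ "{..n}"]) (use n in auto)
    have "(\<Prod>p\<le>n. ?f p) = (\<Prod>p | p \<le> n \<and> prime p \<and> \<not> p dvd q. local_factor E p)"
      by (simp add: prod.If_cases Int_def Collect_conj_eq [symmetric])
    also have "\<dots> = P * (\<Prod>p\<in>T. local_factor E p)"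
      unfolding AT(1) P_def A_def [symmetric] by (rule prod.union_disjoint) fact+
    finally have split: "(\<Prod>p\<le>n. ?f p) = P * (\<Prod>p\<in>T. local_factor E p)" .
    have "1 - 2 * (real m)\<^sup>2 / y \<le> 1 - (real m)\<^sup>2 * (\<Sum>p\<in>T. 1 / (real p)\<^sup>2)"
      using mult_left_mono[OF sum_inverse_squares_le[of y T], of "(real m)\<^sup>2"] y finT Tp
      by (simp add: mult.commute)
    also have "\<dots> = 1 - (\<Sum>p\<in>T. (real m)\<^sup>2 / (real p)\<^sup>2)"
      by (simp add: sum_distrib_left)
    also have "\<dots> \<le> (\<Prod>p\<in>T. 1 - (real m)\<^sup>2 / (real p)\<^sup>2)"
      by (rule Weierstrass_prod_ineq) (use Tp in \<open>fastforce simp: divide_le_eq\<close>)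
    also have "\<dots> \<le> (\<Prod>p\<in>T. local_factor E p)"
    proof (intro prod_mono conjI)
      fix p assume p: "p \<in> T"
      show "0 \<le> 1 - (real m)\<^sup>2 / (real p)\<^sup>2" using Tp[OF p] by (simp add: divide_le_eq)
      show "1 - (real m)\<^sup>2 / (real p)\<^sup>2 \<le> local_factor E p"
        using local_factor_ge[OF fin, of p] Tp[OF p] E by simp
    qed
    finally have lo: "1 - 2 * (real m)\<^sup>2 / y \<le> (\<Prod>p\<in>T. local_factor E p)" .
    have "(\<Prod>p\<in>T. local_factor E p) \<le> (\<Prod>p\<in>T. if p \<in> B then exp (2 * real m / y) else 1)"
    proof (intro prod_mono conjI)
      fix p assume p: "p \<in> T"
      show "0 \<le> local_factor E p" using Tp[OF p] by (intro local_factor_nonneg) auto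
      show "local_factor E p \<le> (if p \<in> B then exp (2 * real m / y) else 1)"
      proof (cases "p \<in> B")
        case True
        have "local_factor E p \<le> exp (2 * real m / real p)"
          using local_factor_le_exp[of p E] Tp[OF p] E by simp
        also have "\<dots> \<le> exp (2 * real m / y)"
          using Tp[OF p] y by (simp add: divide_left_mono)
        finally show ?thesis using True by simp
      next
        case False
        hence "residue_classes_occupied p E = card E"
          using p residue_classes_occupied_le_card[OF fin, of p] unfolding B_def by auto
        thus ?thesis using local_factor_le_1[of p E] Tp[OF p] False by simp
      qed
    qed
    also have "\<dots> = exp (2 * real m / y) ^ card B"
      using BT finT by (simp add: prod.If_cases Int_absorb1)
    also have "\<dots> = exp (2 * real m / y * real (card B))"
      by (simp flip: exp_of_nat_mult add: mult_ac)
    also have "\<dots> \<le> ?C"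
    proof -
      have ly: "ln y > 0" using y by simp
      have "real (card B) * ln y \<le> (real (card E))\<^sup>2 * ln (real H)"
        by (rule card_collision_primes_le[OF E(1) y(1) BT(2) _ H]) (auto simp: B_def T_def)
      hence "real (card B) \<le> (real m)\<^sup>2 * ln (real H) / ln y" using ly E by (simp add: field_simps)
      hence "2 * real m / y * real (card B) \<le> 2 * real m / y * ((real m)\<^sup>2 * ln (real H) / ln y)"
        using y by (intro mult_left_mono) auto
      also have "\<dots> = 2 * real m ^ 3 * ln (real H) / (y * ln y)"
        by (simp add: power2_eq_square power3_eq_cube)
      finally show ?thesis by simp
    qed
    finally have up: "(\<Prod>p\<in>T. local_factor E p) \<le> ?C" .
    show ?thesis unfolding split using lo up P by (auto intro: mult_left_mono)
  qed
  have ev: "eventually (\<lambda>n. real n \<ge> y) sequentially" by real_asymp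
  have "eventually (\<lambda>n. (\<Prod>p\<le>n. ?f p) \<ge> P * (1 - 2 * (real m)\<^sup>2 / y)) sequentially"
    using ev by eventually_elim (use bounds in auto)
  thus "P * (1 - 2 * (real m)\<^sup>2 / y) \<le> sing_prod E q"
    by (rule tendsto_lowerbound[OF sing_prod_LIMSEQ[OF E(1)]]) simp
  have "eventually (\<lambda>n. (\<Prod>p\<le>n. ?f p) \<le> P * ?C) sequentially"
    using ev by eventually_elim (use bounds in auto)
  thus "sing_prod E q \<le> P * ?C"
    by (rule tendsto_upperbound[OF sing_prod_LIMSEQ[OF E(1)]]) simp
qed

definition gallagher_sum :: "nat \<Rightarrow> nat \<Rightarrow> nat \<Rightarrow> real" where
  "gallagher_sum m H q = (\<Sum>E | E \<subseteq> {1..H} \<and> card E = m. sing_prod E q)"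

text \<open>Uniformity in q enters here: dropping the primes that divide q can only shrink \<Prod>Q,
  so its bound 4 powr y \<le> exp (2 * y) holds for every q.\<close>

lemma gallagher_sum_bounds:
  fixes y :: real
  assumes y: "y > 1" "y \<ge> real m" "2 * (real m)\<^sup>2 \<le> y" and H: "H \<ge> 1"
    and W: "(real m + 1) * exp (2 * y) \<le> real H"
  shows "(real H - (real m + 1) * exp (2 * y)) ^ m / fact m * (1 - 2 * (real m)\<^sup>2 / y) \<le> gallagher_sum m H q"
    and "gallagher_sum m H q \<le>
      (real H + exp (2 * y)) ^ m / fact m * exp (2 * real m ^ 3 * ln (real H) / (y * ln y))"
proof -
  define Q where "Q = {p. prime p \<and> real p \<le> y \<and> \<not> p dvd q}"
  have sub: "Q \<subseteq> {p. prime p \<and> p \<le> nat \<lfloor>y\<rfloor>}" unfolding Q_def by (auto simp: le_nat_floor)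
  have Q: "finite Q" "\<And>p. p \<in> Q \<Longrightarrow> prime p"
    by (rule finite_subset[OF sub]) (simp_all add: Q_def)
  have "\<Prod>Q \<le> (\<Prod>p | prime p \<and> p \<le> nat \<lfloor>y\<rfloor>. p)"
  proof (rule dvd_imp_le)
    show "\<Prod>Q dvd (\<Prod>p | prime p \<and> p \<le> nat \<lfloor>y\<rfloor>. p)"
      by (rule prod_dvd_prod_subset) (use sub in simp_all)
    show "(\<Prod>p | prime p \<and> p \<le> nat \<lfloor>y\<rfloor>. p) > 0"
      by (rule prod_pos) (simp add: prime_gt_0_nat)
  qed
  also have "\<dots> \<le> 4 ^ nat \<lfloor>y\<rfloor>" by (rule prod_primes_le_4_power)
  finally have "real (\<Prod>Q) \<le> real (4 ^ nat \<lfloor>y\<rfloor>)" by (subst of_nat_le_iff)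
  also have "\<dots> = 4 powr real (nat \<lfloor>y\<rfloor>)" by (simp add: powr_realpow)
  also have "\<dots> \<le> 4 powr y" using y by (intro powr_mono) auto
  also have "\<dots> = exp (2 * y * ln 2)" using ln_realpow[of 2 2] by (simp add: powr_def)
  also have "\<dots> \<le> exp (2 * y)" using ln_le_minus_one[of 2] y by simp
  finally have WQ: "real (\<Prod>Q) \<le> exp (2 * y)" .
  let ?ES = "{E. E \<subseteq> {1..H} \<and> card E = m}"
  let ?P = "\<lambda>E. \<Prod>p\<in>Q. local_factor E p"
  let ?C = "exp (2 * real m ^ 3 * ln (real H) / (y * ln y))"
  have mW: "(real m + 1) * real (\<Prod>Q) \<le> (real m + 1) * exp (2 * y)"
    using WQ by (intro mult_left_mono) auto
  have "(real H - (real m + 1) * exp (2 * y)) ^ m / fact m \<le> (real H - (real m + 1) * real (\<Prod>Q)) ^ m / fact m"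
    using mW W by (intro divide_right_mono power_mono) auto
  also have "\<dots> \<le> (\<Sum>E\<in>?ES. ?P E)"
    by (rule sum_prod_local_factor_bounds(2)[OF Q order.trans[OF mW W]])
  finally have "(real H - (real m + 1) * exp (2 * y)) ^ m / fact m * (1 - 2 * (real m)\<^sup>2 / y) \<le>
      (\<Sum>E\<in>?ES. ?P E) * (1 - 2 * (real m)\<^sup>2 / y)"
    using y by (intro mult_right_mono) auto
  also have "\<dots> \<le> gallagher_sum m H q"
    unfolding gallagher_sum_def sum_distrib_right
    by (intro sum_mono) (use sing_prod_truncation(1)[OF _ _ y(1,2) H] in \<open>auto simp: Q_def\<close>)
  finally show "(real H - (real m + 1) * exp (2 * y)) ^ m / fact m * (1 - 2 * (real m)\<^sup>2 / y) \<le> gallagher_sum m H q" .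
  have "gallagher_sum m H q \<le> (\<Sum>E\<in>?ES. ?P E) * ?C"
    unfolding gallagher_sum_def sum_distrib_right
    by (intro sum_mono) (use sing_prod_truncation(2)[OF _ _ y(1,2) H] in \<open>auto simp: Q_def\<close>)
  also have "\<dots> \<le> (real H + real (\<Prod>Q)) ^ m / fact m * ?C"
    by (intro mult_right_mono sum_prod_local_factor_bounds(1)[OF Q]) auto
  also have "\<dots> \<le> (real H + exp (2 * y)) ^ m / fact m * ?C"
    by (intro mult_right_mono divide_right_mono power_mono add_left_mono WQ add_nonneg_nonneg of_nat_0_le_iff) auto
  finally show "gallagher_sum m H q \<le> (real H + exp (2 * y)) ^ m / fact m * ?C" .
qed

text \<open>Gallagher's theorem. The choice \<open>y = ln H / 8\<close> keeps the modulus, at most \<open>4 powr y\<close>, far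
  below \<open>H\<close>, while \<open>ln H / (y * ln y)\<close> still tends to 0, which controls the primes above \<open>y\<close>
  for every single \<open>E\<close>.\<close>
lemma gallagher_asymp:
  assumes "filterlim H at_top F"
  shows "((\<lambda>N. gallagher_sum m (H N) (q N) / real (H N) ^ m) \<longlongrightarrow> 1 / fact m) F"
proof (rule tendsto_sandwich)
  let ?y = "\<lambda>h::nat. ln (real h) / 8"
  let ?lo = "\<lambda>h. (1 - (real m + 1) * exp (2 * ?y h) / real h) ^ m / fact m * (1 - 2 * (real m)\<^sup>2 / ?y h)"
  let ?up = "\<lambda>h. (1 + exp (2 * ?y h) / real h) ^ m / fact m * exp (2 * real m ^ 3 * (ln (real h) / (?y h * ln (?y h))))"
  have "eventually (\<lambda>h. ?y h > 1) sequentially" "eventually (\<lambda>h. ?y h \<ge> real m) sequentially"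
    "eventually (\<lambda>h. 2 * (real m)\<^sup>2 \<le> ?y h) sequentially"
    "eventually (\<lambda>h. (real m + 1) * exp (2 * ?y h) \<le> real h) sequentially"
    by real_asymp+
  \<comment> \<open>The quantifier over q stands inside \<open>eventually\<close> because
    \<open>q N\<close> varies together with \<open>H N\<close>.\<close>
  hence ev: "eventually (\<lambda>h. \<forall>q. ?lo h \<le> gallagher_sum m h q / real h ^ m \<and>
      gallagher_sum m h q / real h ^ m \<le> ?up h) sequentially"
    using eventually_ge_at_top[of 1]
  proof eventually_elim
    case (elim h)
    show ?case
    proof (intro allI conjI)
      fix q
      have h: "real h > 0" using elim by simp
      have "?lo h = ((real h - (real m + 1) * exp (2 * ?y h)) / real h) ^ m / fact m * (1 - 2 * (real m)\<^sup>2 / ?y h)"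
        using h by (simp add: diff_divide_distrib)
      also have "\<dots> = (real h - (real m + 1) * exp (2 * ?y h)) ^ m / fact m * (1 - 2 * (real m)\<^sup>2 / ?y h) / real h ^ m"
        by (simp add: power_divide)
      also have "\<dots> \<le> gallagher_sum m h q / real h ^ m"
        by (intro divide_right_mono gallagher_sum_bounds(1)) (use elim in auto)
      finally show "?lo h \<le> gallagher_sum m h q / real h ^ m" .
      have "gallagher_sum m h q / real h ^ m \<le>
         (real h + exp (2 * ?y h)) ^ m / fact m * exp (2 * real m ^ 3 * ln (real h) / (?y h * ln (?y h))) / real h ^ m"
        by (intro divide_right_mono gallagher_sum_bounds(2)) (use elim in auto)
      also have "\<dots> = ((real h + exp (2 * ?y h)) / real h) ^ m / fact m * exp (2 * real m ^ 3 * ln (real h) / (?y h * ln (?y h)))"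
        by (simp add: power_divide)
      also have "\<dots> = ?up h" using h by (simp add: add_divide_distrib)
      finally show "gallagher_sum m h q / real h ^ m \<le> ?up h" .
    qed
  qed
  note ev' = eventually_compose_filterlim[OF ev assms]
  show "eventually (\<lambda>N. ?lo (H N) \<le> gallagher_sum m (H N) (q N) / real (H N) ^ m) F"
    using ev' by eventually_elim auto
  show "eventually (\<lambda>N. gallagher_sum m (H N) (q N) / real (H N) ^ m \<le> ?up (H N)) F"
    using ev' by eventually_elim auto
  \<comment> \<open>\<open>exp (2 * ?y h)\<close> is h powr (1 / 4).\<close>
  have A: "(\<lambda>h. exp (2 * ?y h) / real h) \<longlonglongrightarrow> 0" by real_asymp
  have B: "(\<lambda>h. (real m + 1) * exp (2 * ?y h) / real h) \<longlonglongrightarrow> 0" by real_asymp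
  have C: "(\<lambda>h. 2 * (real m)\<^sup>2 / ?y h) \<longlonglongrightarrow> 0" by real_asymp
  have D: "(\<lambda>h::nat. ln (real h) / (?y h * ln (?y h))) \<longlonglongrightarrow> 0" by real_asymp
  have "?lo \<longlonglongrightarrow> (1 - 0) ^ m / fact m * (1 - 0)"
    by (intro tendsto_mult tendsto_divide tendsto_power tendsto_diff tendsto_const B C) simp
  moreover have "?up \<longlonglongrightarrow> (1 + 0) ^ m / fact m * exp (2 * real m ^ 3 * 0)"
    by (intro tendsto_mult tendsto_divide tendsto_power tendsto_add tendsto_exp tendsto_const A D) simp
  ultimately have "?lo \<longlonglongrightarrow> 1 / fact m" "?up \<longlonglongrightarrow> 1 / fact m" by simp_all
  thus "((\<lambda>N. ?lo (H N)) \<longlongrightarrow> 1 / fact m) F" "((\<lambda>N. ?up (H N)) \<longlongrightarrow> 1 / fact m) F"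
    using assms by (auto intro: filterlim_compose)
qed

section \<open>Prime tuples counted by the conjecture\<close>

lemma residue_classes_occupied_mult:
  assumes "prime p" "\<not> p dvd q"
  shows "residue_classes_occupied p ((*) q ` E) = residue_classes_occupied p E"
proof -
  have cop: "coprime q p" using assms prime_imp_coprime coprime_commute by blast
  let ?h = "\<lambda>x. (q * x) mod p"
  have inj: "inj_on ?h ((\<lambda>d. d mod p) ` E)"
  proof (rule inj_onI)
    fix x y assume x: "x \<in> (\<lambda>d. d mod p) ` E" and y: "y \<in> (\<lambda>d. d mod p) ` E" and eq: "?h x = ?h y"
    have "[q * x = q * y] (mod p)" using eq by (simp add: unique_euclidean_semiring_class.cong_def)
    hence "[x = y] (mod p)" using cop by (simp add: cong_mult_lcancel_nat)
    moreover have "x < p" "y < p" using x y assms(1) prime_gt_0_nat by auto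
    ultimately show "x = y" by (simp add: unique_euclidean_semiring_class.cong_def)
  qed
  have "(\<lambda>d. d mod p) ` (*) q ` E = ?h ` (\<lambda>d. d mod p) ` E"
    by (simp add: image_image mod_mult_right_eq)
  thus ?thesis unfolding residue_classes_occupied_def using inj by (simp add: card_image)
qed

lemma singular_series_multiples:
  assumes "q > 0"
  shows "singular_series ((*) q ` E) q = (real q / real (totient q)) ^ card E * sing_prod E q"
proof -
  have card: "card ((*) q ` E) = card E"
    using assms by (intro card_image) (auto simp: inj_on_def)
  have "(\<Prod>p. if prime p \<and> \<not> p dvd q
          then 1 / (1 - 1 / real p) ^ card ((*) q ` E) *
               (1 - real (residue_classes_occupied p ((*) q ` E)) / real p)
          else 1) = sing_prod E q"
    unfolding sing_prod_def local_factor_def card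
    by (rule prodinf_cong) (simp add: residue_classes_occupied_mult)
  thus ?thesis
    unfolding singular_series_def card by (simp add: power_divide)
qed

lemma sing_prod_singleton: "sing_prod {d} q = 1"
proof -
  have "local_factor {d} p = 1" if "prime p" for p
  proof -
    have "1 - 1 / real p \<noteq> 0" using prime_gt_1_nat[OF that] by (simp add: field_simps)
    thus ?thesis by (simp add: local_factor_def residue_classes_occupied_def)
  qed
  hence "(\<lambda>p. if prime p \<and> \<not> p dvd q then local_factor {d} p else 1) = (\<lambda>_. 1)" by auto
  thus ?thesis unfolding sing_prod_def by simp
qed

lemma coprimes_upto_self: "coprimes_upto q (real q) = totatives q"
  by (auto simp: coprimes_upto_def totatives_def)

lemma coprimes_upto_1: "coprimes_upto 1 (real x) = {1..x}"
  by (auto simp: coprimes_upto_def)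

text \<open>The two specialisations used. With x = q and shifts q * e the sum runs over one reduced
  residue system. With modulus 1 and a single shift d the singular series is 1, and the result is a
  prime number theorem with power saving for the integers from d + 1 to d + x. The parameter D of
  the conjecture is always taken to be N.\<close>

lemma uniform_hardy_littlewood_consequences:
  assumes "uniform_hardy_littlewood"
  obtains \<delta> :: real where "\<delta> > 0"
    and "\<And>m. m \<ge> 1 \<Longrightarrow> \<exists>C\<ge>0. \<forall>q\<ge>1. \<forall>N\<ge>q. \<forall>E. real (totient q) \<le> real N / ln (real N) \<longrightarrow>
      E \<subseteq> {1..} \<longrightarrow> (\<forall>e\<in>E. q * e \<le> N) \<longrightarrow> card E = m \<longrightarrow>
      \<bar>(\<Sum>n\<in>totatives q. \<Prod>e\<in>E. mangoldt (n + q * e)) -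
        (real q / real (totient q)) ^ m * sing_prod E q * real (totient q)\<bar> \<le> C * real N powr (1 - \<delta>)"
    and "\<exists>C\<ge>0. \<forall>N. \<forall>x\<in>{1..N}. \<forall>d\<in>{1..N}. 1 \<le> real N / ln (real N) \<longrightarrow>
      \<bar>(\<Sum>n\<in>{1..x}. mangoldt (n + d)) - real x\<bar> \<le> C * real N powr (1 - \<delta>)"
proof -
  obtain \<delta> where \<delta>: "0 < \<delta>" "\<forall>k\<ge>1. \<exists>C::real. \<forall>q\<ge>1. \<forall>D\<ge>1. \<forall>N\<ge>1. \<forall>\<D>::nat set. \<forall>x::real.
          real (totient q) \<le> real N / ln (real N) \<longrightarrow> D \<le> N \<longrightarrow>
          \<D> \<subseteq> {1..D} \<longrightarrow> card \<D> = k \<longrightarrow> (\<forall>d\<in>\<D>. q dvd d) \<longrightarrow>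
          1 \<le> x \<longrightarrow> x \<le> real N \<longrightarrow>
          \<bar>(\<Sum>n\<in>coprimes_upto q x. \<Prod>d\<in>\<D>. mangoldt (n + d))
             - singular_series \<D> q * real (card (coprimes_upto q x))\<bar>
            \<le> C * real N powr (1 - \<delta>)"
    using assms unfolding uniform_hardy_littlewood_def by blast
  have main: "\<exists>C\<ge>0. \<forall>q\<ge>1. \<forall>N\<ge>1. \<forall>\<D>::nat set. \<forall>x::real.
          real (totient q) \<le> real N / ln (real N) \<longrightarrow>
          \<D> \<subseteq> {1..N} \<longrightarrow> card \<D> = k \<longrightarrow> (\<forall>d\<in>\<D>. q dvd d) \<longrightarrow>
          1 \<le> x \<longrightarrow> x \<le> real N \<longrightarrow>
          \<bar>(\<Sum>n\<in>coprimes_upto q x. \<Prod>d\<in>\<D>. mangoldt (n + d))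
             - singular_series \<D> q * real (card (coprimes_upto q x))\<bar>
            \<le> C * real N powr (1 - \<delta>)" if k: "k \<ge> 1" for k
  proof -
    obtain C where C: "\<forall>q\<ge>1. \<forall>D\<ge>1. \<forall>N\<ge>1. \<forall>\<D>::nat set. \<forall>x::real.
          real (totient q) \<le> real N / ln (real N) \<longrightarrow> D \<le> N \<longrightarrow>
          \<D> \<subseteq> {1..D} \<longrightarrow> card \<D> = k \<longrightarrow> (\<forall>d\<in>\<D>. q dvd d) \<longrightarrow>
          1 \<le> x \<longrightarrow> x \<le> real N \<longrightarrow>
          \<bar>(\<Sum>n\<in>coprimes_upto q x. \<Prod>d\<in>\<D>. mangoldt (n + d))
             - singular_series \<D> q * real (card (coprimes_upto q x))\<bar>
            \<le> C * real N powr (1 - \<delta>)"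
      using \<delta>(2)[THEN spec, THEN mp, OF k] by (rule exE)
    \<comment> \<open>The constant of the conjecture carries no sign; its absolute value gives the
      nonnegative error that the later estimates multiply.\<close>
    have le: "C * real N powr (1 - \<delta>) \<le> \<bar>C\<bar> * real N powr (1 - \<delta>)" for N :: nat
      by (intro mult_right_mono) auto
    show ?thesis
    proof (rule exI[of _ "\<bar>C\<bar>"], intro conjI allI impI)
      fix q N :: nat and \<D> :: "nat set" and x :: real
      assume "q \<ge> 1" "N \<ge> 1" "real (totient q) \<le> real N / ln (real N)" "\<D> \<subseteq> {1..N}" "card \<D> = k"
        "\<forall>d\<in>\<D>. q dvd d" "1 \<le> x" "x \<le> real N"
      thus "\<bar>(\<Sum>n\<in>coprimes_upto q x. \<Prod>d\<in>\<D>. mangoldt (n + d))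
             - singular_series \<D> q * real (card (coprimes_upto q x))\<bar>
            \<le> \<bar>C\<bar> * real N powr (1 - \<delta>)"
        by (intro order.trans[OF C[rule_format, of q N N \<D> x] le]) auto
    qed simp
  qed
  have 1: "\<exists>C\<ge>0. \<forall>q\<ge>1. \<forall>N\<ge>q. \<forall>E. real (totient q) \<le> real N / ln (real N) \<longrightarrow>
      E \<subseteq> {1..} \<longrightarrow> (\<forall>e\<in>E. q * e \<le> N) \<longrightarrow> card E = m \<longrightarrow>
      \<bar>(\<Sum>n\<in>totatives q. \<Prod>e\<in>E. mangoldt (n + q * e)) -
        (real q / real (totient q)) ^ m * sing_prod E q * real (totient q)\<bar> \<le> C * real N powr (1 - \<delta>)"
    if m: "m \<ge> 1" for m
  proof -
    obtain C where C: "C \<ge> 0" "\<forall>q\<ge>1. \<forall>N\<ge>1. \<forall>\<D>::nat set. \<forall>x::real.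
          real (totient q) \<le> real N / ln (real N) \<longrightarrow>
          \<D> \<subseteq> {1..N} \<longrightarrow> card \<D> = m \<longrightarrow> (\<forall>d\<in>\<D>. q dvd d) \<longrightarrow>
          1 \<le> x \<longrightarrow> x \<le> real N \<longrightarrow>
          \<bar>(\<Sum>n\<in>coprimes_upto q x. \<Prod>d\<in>\<D>. mangoldt (n + d))
             - singular_series \<D> q * real (card (coprimes_upto q x))\<bar>
            \<le> C * real N powr (1 - \<delta>)"
      using main[OF m] by blast
    show ?thesis
    proof (rule exI[of _ C], intro conjI allI impI)
      fix q N :: nat and E :: "nat set"
      assume q: "q \<ge> 1" "q \<le> N" and tot: "real (totient q) \<le> real N / ln (real N)"
        and E: "E \<subseteq> {1..}" "\<forall>e\<in>E. q * e \<le> N" "card E = m"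
      have inj: "inj_on ((*) q) E" using q by (auto simp: inj_on_def)
      have sub: "(*) q ` E \<subseteq> {1..N}" using E q by (force simp: Suc_le_eq)
      have "\<bar>(\<Sum>n\<in>coprimes_upto q (real q). \<Prod>d\<in>(*) q ` E. mangoldt (n + d))
             - singular_series ((*) q ` E) q * real (card (coprimes_upto q (real q)))\<bar>
            \<le> C * real N powr (1 - \<delta>)"
        using C(2) q tot sub E(3) card_image[OF inj] by simp
      thus "\<bar>(\<Sum>n\<in>totatives q. \<Prod>e\<in>E. mangoldt (n + q * e)) -
        (real q / real (totient q)) ^ m * sing_prod E q * real (totient q)\<bar> \<le> C * real N powr (1 - \<delta>)"
        using q E(3) by (simp add: coprimes_upto_self singular_series_multiples prod.reindex[OF inj] totient_def)
    qed (rule C(1))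
  qed
  have 2: "\<exists>C\<ge>0. \<forall>N. \<forall>x\<in>{1..N}. \<forall>d\<in>{1..N}. 1 \<le> real N / ln (real N) \<longrightarrow>
      \<bar>(\<Sum>n\<in>{1..x}. mangoldt (n + d)) - real x\<bar> \<le> C * real N powr (1 - \<delta>)"
  proof -
    obtain C where C: "C \<ge> 0" "\<forall>q\<ge>1. \<forall>N\<ge>1. \<forall>\<D>::nat set. \<forall>x::real.
          real (totient q) \<le> real N / ln (real N) \<longrightarrow>
          \<D> \<subseteq> {1..N} \<longrightarrow> card \<D> = 1 \<longrightarrow> (\<forall>d\<in>\<D>. q dvd d) \<longrightarrow>
          1 \<le> x \<longrightarrow> x \<le> real N \<longrightarrow>
          \<bar>(\<Sum>n\<in>coprimes_upto q x. \<Prod>d\<in>\<D>. mangoldt (n + d))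
             - singular_series \<D> q * real (card (coprimes_upto q x))\<bar>
            \<le> C * real N powr (1 - \<delta>)"
      using main[of 1] by blast
    show ?thesis
    proof (rule exI[of _ C], intro conjI allI impI ballI)
      fix N x d :: nat
      assume x: "x \<in> {1..N}" and d: "d \<in> {1..N}" and N: "1 \<le> real N / ln (real N)"
      have "\<bar>(\<Sum>n\<in>coprimes_upto 1 (real x). \<Prod>d\<in>{d}. mangoldt (n + d))
             - singular_series {d} 1 * real (card (coprimes_upto 1 (real x)))\<bar>
            \<le> C * real N powr (1 - \<delta>)"
        using C(2)[rule_format, of 1 N "{d}" "real x"] x d N by simp
      moreover have "singular_series {d} 1 = 1"
        using singular_series_multiples[of 1 "{d}"] by (simp add: sing_prod_singleton)
      ultimately show "\<bar>(\<Sum>n\<in>{1..x}. mangoldt (n + d)) - real x\<bar> \<le> C * real N powr (1 - \<delta>)"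
        unfolding coprimes_upto_1 by simp
    qed (rule C(1))
  qed
  show ?thesis by (rule that[OF \<delta>(1) 1 2])
qed

section \<open>From the von Mangoldt function to primes\<close>

definition proper_primepow :: "nat \<Rightarrow> bool" where
  "proper_primepow x \<longleftrightarrow> primepow x \<and> \<not> prime x"

text \<open>Such a number is p ^ k with k \<ge> 2, so p \<le> sqrt N, and 2 ^ k \<le> N bounds k.
  Counting all pairs of p and k overcounts, but any power saving over N is enough.\<close>

lemma card_proper_primepow_le:
  assumes "N \<ge> 1"
  shows "real (card {x. x \<le> N \<and> proper_primepow x}) \<le> sqrt (real N) * (2 * ln (real N))"
proof -
  let ?A = "{1..nat \<lfloor>sqrt (real N)\<rfloor>} \<times> {1..nat \<lfloor>2 * ln (real N)\<rfloor>}"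
  have "{x. x \<le> N \<and> proper_primepow x} \<subseteq> (\<lambda>(p, k). p ^ k) ` ?A"
  proof
    fix x assume "x \<in> {x. x \<le> N \<and> proper_primepow x}"
    then obtain p k where x: "x \<le> N" "prime p" "k > 0" "x = p ^ k" "\<not> prime x"
      unfolding proper_primepow_def primepow_def by auto
    have k: "k \<ge> 2" using x by (cases "k = 1") auto
    have p2: "p \<ge> 2" using x(2) by (rule prime_ge_2_nat)
    have "p\<^sup>2 \<le> p ^ k" using k p2 by (intro power_increasing) auto
    hence "(real p)\<^sup>2 \<le> real N" using x(1,4) by (metis of_nat_le_iff of_nat_power order.trans)
    hence "real p \<le> sqrt (real N)" by (rule real_le_rsqrt)
    hence 1: "p \<in> {1..nat \<lfloor>sqrt (real N)\<rfloor>}" using p2 by (simp add: le_nat_floor)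
    have "2 ^ k \<le> p ^ k" using p2 by (rule power_mono) auto
    hence "2 ^ k \<le> real N" using x(1,4) by (metis of_nat_le_iff of_nat_power order.trans of_nat_numeral)
    hence "ln (2 ^ k) \<le> ln (real N)" by (intro ln_mono) (use assms in auto)
    hence "real k * ln 2 \<le> ln (real N)" by (simp add: ln_realpow)
    moreover have "real k * (1 / 2) \<le> real k * ln 2"
      using ln_le_minus_one[of "1 / 2"] by (intro mult_left_mono) (auto simp: ln_div)
    ultimately have "real k \<le> 2 * ln (real N)" by linarith
    hence 2: "k \<in> {1..nat \<lfloor>2 * ln (real N)\<rfloor>}" using k by (simp add: le_nat_floor)
    show "x \<in> (\<lambda>(p, k). p ^ k) ` ?A"
      by (rule image_eqI[of _ _ "(p, k)"]) (use 1 2 x in auto)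
  qed
  hence "card {x. x \<le> N \<and> proper_primepow x} \<le> card ?A"
    by (rule surj_card_le[rotated]) simp
  hence "card {x. x \<le> N \<and> proper_primepow x} \<le> nat \<lfloor>sqrt (real N)\<rfloor> * nat \<lfloor>2 * ln (real N)\<rfloor>"
    by simp
  hence "real (card {x. x \<le> N \<and> proper_primepow x}) \<le>
      real (nat \<lfloor>sqrt (real N)\<rfloor>) * real (nat \<lfloor>2 * ln (real N)\<rfloor>)"
    by (subst of_nat_mult [symmetric], subst of_nat_le_iff)
  also have "\<dots> \<le> sqrt (real N) * (2 * ln (real N))"
    using assms by (intro mult_mono) auto
  finally show ?thesis .
qed

definition prime_tuples :: "nat \<Rightarrow> nat set \<Rightarrow> nat set" where
  "prime_tuples q E = {n\<in>totatives q. \<forall>e\<in>E. prime (n + q * e)}"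

text \<open>Since every e is at least 1, each entry n + q * e is at least q, so its von Mangoldt
  value at a prime is at least ln q. For e = 0 the entry n could be small and no such bound would
  hold.\<close>

lemma card_prime_tuples_le:
  assumes "finite E" "0 \<notin> E" "q \<ge> 1"
  shows "real (card (prime_tuples q E)) * ln (real q) ^ card E \<le>
    (\<Sum>n\<in>totatives q. \<Prod>e\<in>E. mangoldt (n + q * e))"
proof -
  have "real (card (prime_tuples q E)) * ln (real q) ^ card E = (\<Sum>n\<in>prime_tuples q E. \<Prod>e\<in>E. ln (real q))"
    by simp
  also have "\<dots> \<le> (\<Sum>n\<in>prime_tuples q E. \<Prod>e\<in>E. mangoldt (n + q * e))"
  proof (intro sum_mono prod_mono conjI)
    fix n e assume n: "n \<in> prime_tuples q E" and e: "e \<in> E"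
    have "e \<ge> 1" using e assms by (cases e) auto
    hence "q \<le> n + q * e" by (simp add: trans_le_add2)
    hence "ln (real q) \<le> ln (real (n + q * e))"
      using assms(3) by (intro ln_mono) linarith+
    also have "\<dots> = mangoldt (n + q * e)"
      using n e by (simp add: prime_tuples_def del: of_nat_add of_nat_mult)
    finally show "ln (real q) \<le> mangoldt (n + q * e)" .
    show "0 \<le> ln (real q)" using assms by simp
  qed
  also have "\<dots> \<le> (\<Sum>n\<in>totatives q. \<Prod>e\<in>E. mangoldt (n + q * e))"
    by (rule sum_mono2) (auto simp: prime_tuples_def intro!: prod_nonneg mangoldt_nonneg)
  finally show ?thesis .
qed

text \<open>A nonzero product has only prime powers as entries, so either all entries are prime or
  one of them is a proper prime power. For fixed e the shift by q * e is injective, so the second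
  case costs at most the number of proper prime powers up to N for each e.\<close>

lemma sum_mangoldt_tuples_le:
  assumes E: "finite E" "\<And>e. e \<in> E \<Longrightarrow> q + q * e \<le> N" and N: "N \<ge> 1"
  shows "(\<Sum>n\<in>totatives q. \<Prod>e\<in>E. mangoldt (n + q * e)) \<le> ln (real N) ^ card E *
    (real (card (prime_tuples q E)) + real (card E) * real (card {x. x \<le> N \<and> proper_primepow x}))"
proof -
  let ?L = "ln (real N) ^ card E"
  let ?pp = "\<lambda>n e. (if proper_primepow (n + q * e) then 1 else 0 :: real)"
  have L: "?L \<ge> 0" using N by simp
  have pw: "(\<Prod>e\<in>E. mangoldt (n + q * e)) \<le>
      ?L * ((if n \<in> prime_tuples q E then 1 else 0) + (\<Sum>e\<in>E. ?pp n e))" if n: "n \<in> totatives q" for n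
  proof -
    have bound: "(\<Prod>e\<in>E. mangoldt (n + q * e)) \<le> ?L"
    proof -
      have "(\<Prod>e\<in>E. mangoldt (n + q * e)) \<le> (\<Prod>e\<in>E. ln (real N))"
      proof (intro prod_mono conjI mangoldt_nonneg)
        fix e assume "e \<in> E"
        hence le: "0 < n + q * e" "n + q * e \<le> N" using E(2)[of e] n by (auto simp: totatives_def)
        have "mangoldt (n + q * e) \<le> ln (real (n + q * e))" by (rule mangoldt_le[OF le(1)])
        also have "\<dots> \<le> ln (real N)" using le by (intro ln_mono) linarith+
        finally show "mangoldt (n + q * e) \<le> ln (real N)" .
      qed
      thus ?thesis by simp
    qed
    have nn: "0 \<le> (\<Sum>e\<in>E. ?pp n e)" by (intro sum_nonneg) auto
    show ?thesis
    proof (cases "n \<in> prime_tuples q E")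
      case True
      have "?L * 1 \<le> ?L * (1 + (\<Sum>e\<in>E. ?pp n e))" using L nn by (intro mult_left_mono) auto
      thus ?thesis using bound True by simp
    next
      case False
      then obtain e where e: "e \<in> E" "\<not> prime (n + q * e)" using n by (auto simp: prime_tuples_def)
      show ?thesis
      proof (cases "primepow (n + q * e)")
        case True
        hence "1 = ?pp n e" using e by (simp add: proper_primepow_def)
        also have "\<dots> \<le> (\<Sum>e\<in>E. ?pp n e)" by (rule member_le_sum) (use e E in auto)
        finally have "?L * 1 \<le> ?L * (\<Sum>e\<in>E. ?pp n e)" using L by (intro mult_left_mono) auto
        thus ?thesis using bound False by simp
      next
        case False
        hence "(\<Prod>e\<in>E. mangoldt (n + q * e)) = (0::real)"
          using e E by (intro prod_zero) (auto simp: mangoldt_def)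
        thus ?thesis using L nn by (simp add: mult_nonneg_nonneg)
      qed
    qed
  qed
  have "(\<Sum>n\<in>totatives q. \<Prod>e\<in>E. mangoldt (n + q * e)) \<le>
      (\<Sum>n\<in>totatives q. ?L * ((if n \<in> prime_tuples q E then 1 else 0) + (\<Sum>e\<in>E. ?pp n e)))"
    by (intro sum_mono pw)
  also have "\<dots> = ?L * ((\<Sum>n\<in>totatives q. if n \<in> prime_tuples q E then 1 else 0) +
      (\<Sum>e\<in>E. \<Sum>n\<in>totatives q. ?pp n e))"
    by (simp add: sum_distrib_left [symmetric] sum.distrib sum.swap[of _ E])
  also have "(\<Sum>n\<in>totatives q. if n \<in> prime_tuples q E then 1 else 0) = real (card (prime_tuples q E))"
  proof -
    have "totatives q \<inter> prime_tuples q E = prime_tuples q E" by (auto simp: prime_tuples_def)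
    thus ?thesis by (simp add: sum.If_cases)
  qed
  also have "?L * (real (card (prime_tuples q E)) + (\<Sum>e\<in>E. \<Sum>n\<in>totatives q. ?pp n e)) \<le>
      ?L * (real (card (prime_tuples q E)) + (\<Sum>e\<in>E. real (card {x. x \<le> N \<and> proper_primepow x})))"
  proof (intro mult_left_mono add_left_mono sum_mono L)
    fix e assume e: "e \<in> E"
    have "(\<lambda>n. n + q * e) ` {n\<in>totatives q. proper_primepow (n + q * e)} \<subseteq> {x. x \<le> N \<and> proper_primepow x}"
      using E(2)[OF e] by (auto simp: totatives_def)
    hence "card {n\<in>totatives q. proper_primepow (n + q * e)} \<le> card {x. x \<le> N \<and> proper_primepow x}"
      by (intro card_inj_on_le[of "\<lambda>n. n + q * e"]) auto
    thus "(\<Sum>n\<in>totatives q. ?pp n e) \<le> real (card {x. x \<le> N \<and> proper_primepow x})"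
      by (simp add: sum.If_cases Int_def)
  qed
  finally show ?thesis by simp
qed

definition prime_hits :: "nat \<Rightarrow> nat \<Rightarrow> nat \<Rightarrow> nat" where
  "prime_hits q H a = card {e\<in>{1..H}. prime (a + q * e)}"

text \<open>Double counting of the pairs of a and E such that a + q * e is prime for every e in
  E.\<close>

lemma sum_prime_hits_choose:
  "(\<Sum>a\<in>totatives q. prime_hits q H a choose m) =
    (\<Sum>E | E \<subseteq> {1..H} \<and> card E = m. card (prime_tuples q E))"
proof -
  let ?ES = "{E. E \<subseteq> {1..H} \<and> card E = m}"
  have fin: "finite ?ES" by (rule finite_subset[of _ "Pow {1..H}"]) auto
  have "(\<Sum>E\<in>?ES. card (prime_tuples q E)) =
      (\<Sum>E\<in>?ES. \<Sum>a\<in>totatives q. if \<forall>e\<in>E. prime (a + q * e) then 1 else 0)"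
    by (simp add: sum.If_cases Int_def prime_tuples_def)
  also have "\<dots> = (\<Sum>a\<in>totatives q. \<Sum>E\<in>?ES. if \<forall>e\<in>E. prime (a + q * e) then 1 else 0)"
    by (rule sum.swap)
  also have "\<dots> = (\<Sum>a\<in>totatives q. prime_hits q H a choose m)"
  proof (rule sum.cong)
    fix a
    have "(\<Sum>E\<in>?ES. if \<forall>e\<in>E. prime (a + q * e) then 1 else 0) = card (?ES \<inter> {E. \<forall>e\<in>E. prime (a + q * e)})"
      using fin by (simp add: sum.If_cases)
    also have "?ES \<inter> {E. \<forall>e\<in>E. prime (a + q * e)} = {E. E \<subseteq> {e\<in>{1..H}. prime (a + q * e)} \<and> card E = m}"
      by blast
    also have "card \<dots> = prime_hits q H a choose m"
      unfolding prime_hits_def by (rule n_subsets) auto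
    finally show "(\<Sum>E\<in>?ES. if \<forall>e\<in>E. prime (a + q * e) then 1 else 0) = \<dots>" .
  qed simp
  finally show ?thesis by simp
qed

lemma card_subsets_le_power: "card {E. E \<subseteq> {1..H} \<and> card E = m} \<le> H ^ m"
proof -
  have "card {E. E \<subseteq> {1..H} \<and> card E = m} = H choose m" by (simp add: n_subsets)
  also have "\<dots> \<le> H ^ m" using binomial_le_pow[of m H] by (cases "m \<le> H") (auto simp: binomial_eq_0)
  finally show ?thesis .
qed

text \<open>Each \<open>mangoldt\<close> value at a prime occurring here lies between \<open>ln q\<close> and \<open>ln N\<close>, which agree asymptotically.\<close>
lemma factorial_moment_bounds:
  fixes R :: real
  assumes q: "q \<ge> 2" and H: "q + q * H \<le> N" and R: "R \<ge> 0"
    and HL: "\<And>E. E \<subseteq> {1..H} \<Longrightarrow> card E = m \<Longrightarrow>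
      \<bar>(\<Sum>n\<in>totatives q. \<Prod>e\<in>E. mangoldt (n + q * e)) -
        (real q / real (totient q)) ^ m * sing_prod E q * real (totient q)\<bar> \<le> R"
  defines "M \<equiv> (\<Sum>a\<in>totatives q. real (prime_hits q H a choose m)) / real (totient q)"
  shows "M \<le> (real q / (real (totient q) * ln (real q))) ^ m * gallagher_sum m H q +
      (real H / ln (real q)) ^ m * R / real (totient q)"
    and "(real q / (real (totient q) * ln (real N))) ^ m * gallagher_sum m H q -
      (real H / ln (real N)) ^ m * R / real (totient q) -
      real H ^ m * real m * real (card {x. x \<le> N \<and> proper_primepow x}) / real (totient q) \<le> M"
proof -
  let ?ES = "{E. E \<subseteq> {1..H} \<and> card E = m}" and ?\<phi> = "real (totient q)"
  let ?S = "\<lambda>E. (\<Sum>n\<in>totatives q. \<Prod>e\<in>E. mangoldt (n + q * e)) :: real"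
  let ?PP = "real (card {x. x \<le> N \<and> proper_primepow x})"
  have N: "N \<ge> 2" using q H by linarith
  have lq: "ln (real q) > 0" and lN: "ln (real N) > 0" using q N by auto
  have \<phi>: "?\<phi> > 0" using q by simp
  have M: "M * ?\<phi> = (\<Sum>E\<in>?ES. real (card (prime_tuples q E)))"
    unfolding M_def using \<phi> sum_prime_hits_choose[of q H m] by (simp flip: of_nat_sum)
  have fin: "finite ?ES" by (rule finite_subset[of _ "Pow {1..H}"]) auto
  have "real (card ?ES) \<le> real H ^ m" using card_subsets_le_power[of H m] by (simp flip: of_nat_power)
  \<comment> \<open>Only the error terms replace the number of sets E by \<open>H ^ m\<close>; the
    main term is summed exactly, as \<open>gallagher_sum\<close>.\<close>
  hence cardES: "real (card ?ES) * c \<le> real H ^ m * c" if "c \<ge> 0" for c :: real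
    using that by (intro mult_right_mono)
  have E: "finite E" "0 \<notin> E" "\<And>e. e \<in> E \<Longrightarrow> q + q * e \<le> N" "card E = m" if "E \<in> ?ES" for E
  proof -
    show "q + q * e \<le> N" if "e \<in> E" for e
    proof -
      have "q * e \<le> q * H" using \<open>E \<in> ?ES\<close> that by (intro mult_left_mono) auto
      thus ?thesis using H by linarith
    qed
  qed (use that finite_subset[of E "{1..H}"] in auto)
  let ?c = "(real q / ?\<phi>) ^ m"
  have "M * ?\<phi> \<le> (\<Sum>E\<in>?ES. (?c * sing_prod E q * ?\<phi> + R) / ln (real q) ^ m)"
    unfolding M
  proof (rule sum_mono)
    fix E assume EE: "E \<in> ?ES"
    have "real (card (prime_tuples q E)) * ln (real q) ^ m \<le> ?S E"
      using card_prime_tuples_le[of E q] E[OF EE] q by simp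
    also have "\<dots> \<le> ?c * sing_prod E q * ?\<phi> + R"
      using HL[of E] EE by (auto simp: abs_le_iff)
    finally show "real (card (prime_tuples q E)) \<le> (?c * sing_prod E q * ?\<phi> + R) / ln (real q) ^ m"
      using lq by (simp add: pos_le_divide_eq)
  qed
  also have "\<dots> = (?c * gallagher_sum m H q * ?\<phi> + real (card ?ES) * R) / ln (real q) ^ m"
    by (simp add: sum_divide_distrib [symmetric] sum.distrib gallagher_sum_def sum_distrib_left sum_distrib_right)
  also have "\<dots> \<le> (?c * gallagher_sum m H q * ?\<phi> + real H ^ m * R) / ln (real q) ^ m"
    using cardES[OF R] lq by (intro divide_right_mono add_left_mono) auto
  finally have "M \<le> ((?c * gallagher_sum m H q * ?\<phi> + real H ^ m * R) / ln (real q) ^ m) / ?\<phi>"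
    by (subst pos_le_divide_eq[OF \<phi>])
  also have "\<dots> = (real q / (?\<phi> * ln (real q))) ^ m * gallagher_sum m H q +
      (real H / ln (real q)) ^ m * R / ?\<phi>"
    using \<phi> lq by (simp add: power_divide power_mult_distrib field_simps)
  finally show "M \<le> (real q / (?\<phi> * ln (real q))) ^ m * gallagher_sum m H q +
      (real H / ln (real q)) ^ m * R / ?\<phi>" .
  let ?L = "ln (real N) ^ m"
  have L: "?L > 0" using lN by simp
  have "(?c * gallagher_sum m H q * ?\<phi> - real H ^ m * R) / ?L - real H ^ m * (real m * ?PP) \<le>
      (?c * gallagher_sum m H q * ?\<phi> - real (card ?ES) * R) / ?L - real (card ?ES) * (real m * ?PP)"
    using cardES[OF R] cardES[of "real m * ?PP"] L by (intro diff_mono divide_right_mono) auto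
  also have "\<dots> = (\<Sum>E\<in>?ES. (?c * sing_prod E q * ?\<phi> - R) / ?L - real m * ?PP)"
    by (simp add: sum_divide_distrib [symmetric] sum_subtractf gallagher_sum_def sum_distrib_left sum_distrib_right)
  also have "\<dots> \<le> M * ?\<phi>"
    unfolding M
  proof (rule sum_mono)
    fix E assume EE: "E \<in> ?ES"
    have "?c * sing_prod E q * ?\<phi> - R \<le> ?S E"
      using HL[of E] EE by (auto simp: abs_le_iff)
    also have "\<dots> \<le> ?L * (real (card (prime_tuples q E)) + real m * ?PP)"
      using sum_mangoldt_tuples_le[of E q N] E[OF EE] N by simp
    finally show "(?c * sing_prod E q * ?\<phi> - R) / ?L - real m * ?PP \<le> real (card (prime_tuples q E))"
      using L by (simp add: pos_divide_le_eq diff_le_eq mult.commute)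
  qed
  finally have "((?c * gallagher_sum m H q * ?\<phi> - real H ^ m * R) / ?L - real H ^ m * (real m * ?PP)) / ?\<phi> \<le> M"
    by (subst pos_divide_le_eq[OF \<phi>])
  moreover have "((?c * gallagher_sum m H q * ?\<phi> - real H ^ m * R) / ?L - real H ^ m * (real m * ?PP)) / ?\<phi> =
    (real q / (?\<phi> * ln (real N))) ^ m * gallagher_sum m H q -
      (real H / ln (real N)) ^ m * R / ?\<phi> - real H ^ m * real m * ?PP / ?\<phi>"
    using \<phi> lN by (simp add: power_divide power_mult_distrib field_simps)
  ultimately show "(real q / (?\<phi> * ln (real N))) ^ m * gallagher_sum m H q -
      (real H / ln (real N)) ^ m * R / ?\<phi> - real H ^ m * real m * ?PP / ?\<phi> \<le> M" by simp
qed

section \<open>Factorial moments and the Poisson limit\<close>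

lemma tendsto_cong_limit:
  assumes "(f \<longlongrightarrow> l) F" "eventually (\<lambda>x. f x = g x) F" "l = l'"
  shows "(g \<longlongrightarrow> l') F"
  using Lim_transform_eventually[OF assms(1,2)] assms(3) by simp

text \<open>Moment limits are available only at a fixed truncation level, so J is chosen first,
  making \<open>b J\<close> close to t and \<open>e J\<close> small, and the limit along F is taken
  afterwards.\<close>

lemma tendsto_approximation:
  fixes x :: "'a \<Rightarrow> real"
  assumes u: "\<And>J::nat. (u J \<longlongrightarrow> b J) F" and v: "\<And>J. (v J \<longlongrightarrow> e J) F"
    and xuv: "\<And>J. eventually (\<lambda>n. \<bar>x n - u J n\<bar> \<le> v J n) F"
    and b: "b \<longlonglongrightarrow> t" and e: "e \<longlonglongrightarrow> 0"
  shows "(x \<longlongrightarrow> t) F"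
proof (rule tendstoI)
  fix \<epsilon> :: real assume \<epsilon>: "\<epsilon> > 0"
  have "eventually (\<lambda>J. \<bar>b J - t\<bar> < \<epsilon> / 4 \<and> e J < \<epsilon> / 4) sequentially"
    using tendstoD[OF b, of "\<epsilon> / 4"] order_tendstoD(2)[OF e, of "\<epsilon> / 4"] \<epsilon>
    by (auto simp: dist_real_def eventually_conj_iff)
  then obtain J where J: "\<bar>b J - t\<bar> < \<epsilon> / 4" "e J < \<epsilon> / 4"
    using eventually_happens'[OF sequentially_bot] by blast
  have "eventually (\<lambda>n. dist (u J n) (b J) < \<epsilon> / 4) F" by (rule tendstoD[OF u]) (use \<epsilon> in simp)
  moreover have "eventually (\<lambda>n. v J n < \<epsilon> / 4) F" by (rule order_tendstoD(2)[OF v J(2)])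
  ultimately show "eventually (\<lambda>n. dist (x n) t < \<epsilon>) F"
    using xuv[of J]
  proof eventually_elim
    case (elim n)
    thus ?case using J unfolding dist_real_def by linarith
  qed
qed

section \<open>Sizes of \<open>q N\<close>, \<open>H N\<close> and the logarithms\<close>

locale critical_modulus =
  fixes q :: "nat \<Rightarrow> nat" and lam :: real
  assumes lam: "lam > 0"
    and asymp: "(\<lambda>N. real (totient (q N))) \<sim>[at_top] (\<lambda>N. real N / (lam * ln (real N)))"
begin

abbreviation tot :: "nat \<Rightarrow> real" where "tot N \<equiv> real (totient (q N))"
abbreviation L :: "nat \<Rightarrow> real" where "L N \<equiv> ln (real N)"

lemma tot_asymp: "(\<lambda>N. tot N * L N / real N) \<longlonglongrightarrow> 1 / lam"
proof -
  have "eventually (\<lambda>N. real N / (lam * L N) \<noteq> 0) sequentially"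
    using eventually_gt_at_top[of 1] by eventually_elim (use lam in auto)
  hence "(\<lambda>N. tot N / (real N / (lam * L N))) \<longlonglongrightarrow> 1"
    by (intro asymp_equivD_strong[OF asymp]) (auto elim: eventually_mono)
  hence "(\<lambda>N. tot N / (real N / (lam * L N)) / lam) \<longlonglongrightarrow> 1 / lam"
    by (intro tendsto_divide tendsto_const) (use lam in auto)
  thus ?thesis using lam by simp
qed

lemma ev_tot_bounds:
  "eventually (\<lambda>N. real N / (2 * lam * L N) \<le> tot N \<and> tot N \<le> 2 * real N / (lam * L N)) sequentially"
proof -
  have "1 / (2 * lam) < 1 / lam" "1 / lam < 2 / lam" using lam by (simp_all add: field_simps)
  hence "eventually (\<lambda>N. tot N * L N / real N > 1 / (2 * lam)) sequentially"
    "eventually (\<lambda>N. tot N * L N / real N < 2 / lam) sequentially"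
    using tot_asymp order_tendstoD by blast+
  thus ?thesis using eventually_gt_at_top[of 1]
  proof eventually_elim
    case (elim N)
    hence "real N > 0" "L N > 0" by auto
    thus ?case using elim lam by (simp add: field_simps)
  qed
qed

lemma tot_at_top: "filterlim tot at_top sequentially"
proof (rule filterlim_at_top_mono)
  show "filterlim (\<lambda>N. real N / (2 * lam * L N)) at_top sequentially" using lam by real_asymp
  show "eventually (\<lambda>N. real N / (2 * lam * L N) \<le> tot N) sequentially"
    using ev_tot_bounds by eventually_elim auto
qed

lemma q_at_top: "filterlim q at_top sequentially"
  unfolding filterlim_sequentially_iff_filterlim_real
  by (rule filterlim_at_top_mono[OF tot_at_top]) (auto intro!: always_eventually totient_le)

text \<open>\<open>eventually_le_totient_ln\<close> saves over ln q, while the claim concerns ln N,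
  and q \<le> N is not known yet. A bootstrap suffices: ln q \<le> sqrt q and q \<le> totient q * ln
  q yield sqrt q \<le> totient q, so \<open>q \<le> (totient q)\<^sup>2 \<le> N\<^sup>2\<close> and
  ln q \<le> 2 * ln N. The choice e / 4 leaves room for this 2 and for strictness.\<close>

lemma q_over_tot: "(\<lambda>N. real (q N) / (tot N * L N)) \<longlonglongrightarrow> 0"
proof (rule tendstoI)
  fix e :: real assume e: "e > 0"
  have ev_q: "eventually (\<lambda>N. P (q N)) sequentially" if "eventually P sequentially" for P
    using eventually_compose_filterlim[OF that q_at_top] .
  have "eventually (\<lambda>n. ln (real n) \<le> sqrt (real n)) sequentially" by real_asymp
  moreover have "eventually (\<lambda>n. real n \<le> 1 * real (totient n) * ln (real n)) sequentially"
    by (rule eventually_le_totient_ln) simp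
  moreover have "eventually (\<lambda>n. real n \<le> (e / 4) * real (totient n) * ln (real n)) sequentially"
    by (rule eventually_le_totient_ln) (use e in simp)
  ultimately have "eventually (\<lambda>n. ln (real n) \<le> sqrt (real n) \<and> real n \<le> real (totient n) * ln (real n) \<and>
      real n \<le> (e / 4) * real (totient n) * ln (real n)) sequentially"
    by eventually_elim auto
  note 1 = ev_q[OF this]
  have "eventually (\<lambda>N. 2 * real N / (lam * L N) \<le> real N) sequentially" using lam by real_asymp
  with 1 ev_tot_bounds show "eventually (\<lambda>N. dist (real (q N) / (tot N * L N)) 0 < e) sequentially"
    using eventually_gt_at_top[of 1] eventually_compose_filterlim[OF eventually_gt_at_top[of 1] q_at_top]
  proof eventually_elim
    case (elim N)
    have tot: "tot N > 0" and q: "real (q N) > 1" using elim by auto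
    have L: "L N > 0" using elim by simp
    have "tot N * ln (real (q N)) \<le> tot N * sqrt (real (q N))"
      using elim by (intro mult_left_mono) auto
    moreover have "sqrt (real (q N)) * sqrt (real (q N)) = real (q N)" by simp
    ultimately have "sqrt (real (q N)) * sqrt (real (q N)) \<le> tot N * sqrt (real (q N))"
      using elim by linarith
    hence "sqrt (real (q N)) \<le> tot N" by (rule mult_right_le_imp_le) (use q in simp)
    hence "real (q N) \<le> (tot N)\<^sup>2" using real_sqrt_le_iff real_le_lsqrt sqrt_le_D by blast
    hence "ln (real (q N)) \<le> ln ((tot N)\<^sup>2)" using q by (intro ln_mono) auto
    also have "\<dots> = 2 * ln (tot N)" using tot by (simp add: ln_realpow)
    also have "ln (tot N) \<le> L N" using elim tot by (intro ln_mono) auto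
    finally have lnq: "ln (real (q N)) \<le> 2 * L N" by simp
    have "real (q N) \<le> (e / 4) * tot N * ln (real (q N))" using elim by simp
    also have "\<dots> \<le> (e / 4) * tot N * (2 * L N)" using lnq e tot by (intro mult_left_mono) auto
    also have "\<dots> < e * (tot N * L N)" using e tot L by simp
    finally have "real (q N) / (tot N * L N) < e" using tot L by (simp add: pos_divide_less_eq)
    thus ?case using tot L by simp
  qed
qed

lemma q_over_N: "(\<lambda>N. real (q N) / real N) \<longlonglongrightarrow> 0"
proof -
  have "(\<lambda>N. (real (q N) / (tot N * L N)) * (tot N * L N / real N)) \<longlonglongrightarrow> 0 * (1 / lam)"
    by (intro tendsto_mult q_over_tot tot_asymp)
  moreover have "eventually (\<lambda>N. (real (q N) / (tot N * L N)) * (tot N * L N / real N) = real (q N) / real N) sequentially"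
    using eventually_gt_at_top[of 1] eventually_compose_filterlim[OF eventually_gt_at_top[of 1] q_at_top]
    by eventually_elim auto
  ultimately show ?thesis by (rule tendsto_cong_limit) (use lam in simp)
qed

text \<open>Once q \<le> N, this is the largest H with q + q * H \<le> N, so that a + q * e \<le> N
  whenever a \<le> q and e \<le> H. At the next index e = N div q it depends on a whether a + q * e
  exceeds N.\<close>

definition H :: "nat \<Rightarrow> nat" where "H N = N div q N - 1"

lemma ev_div_ge: "eventually (\<lambda>N. N div q N \<ge> Z \<and> q N \<ge> 2 \<and> N \<ge> 2) sequentially"
proof -
  have "eventually (\<lambda>N. real (q N) / real N < 1 / (real Z + 1)) sequentially"
    by (rule order_tendstoD[OF q_over_N]) auto
  thus ?thesis
    using eventually_ge_at_top[of 2] eventually_compose_filterlim[OF eventually_ge_at_top[of 2] q_at_top]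
  proof eventually_elim
    case (elim N)
    have "real (q N) * (real Z + 1) < real N" using elim by (simp add: field_simps)
    hence "real (q N) * real Z \<le> real N" by (simp add: algebra_simps)
    hence "Z * q N \<le> N" by (metis mult.commute of_nat_le_iff of_nat_mult)
    thus ?case using elim by (simp add: less_eq_div_iff_mult_less_eq)
  qed
qed

lemma H_at_top: "filterlim H at_top sequentially"
  unfolding filterlim_at_top
proof
  fix Z
  show "eventually (\<lambda>N. Z \<le> H N) sequentially"
    using ev_div_ge[of "Z + 1"] by eventually_elim (auto simp: H_def)
qed

lemma ev_qH: "eventually (\<lambda>N. q N + q N * H N \<le> N \<and> real N \<le> real (q N) * real (H N) + 2 * real (q N)) sequentially"
  using ev_div_ge[of 1]
proof eventually_elim
  case (elim N)
  then obtain M where M: "N div q N = Suc M" by (cases "N div q N") auto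
  have H: "H N = M" unfolding H_def M by simp
  have N: "q N * Suc M + N mod q N = N" using mult_div_mod_eq[of "q N" N] unfolding M .
  moreover have "N mod q N < q N" using elim by simp
  ultimately have "q N + q N * M \<le> N" "N \<le> q N * M + 2 * q N" unfolding mult_Suc_right by linarith+
  thus ?case unfolding H by (metis (mono_tags) of_nat_add of_nat_le_iff of_nat_mult of_nat_numeral)
qed

lemma qH_over_N: "(\<lambda>N. real (q N) * real (H N) / real N) \<longlonglongrightarrow> 1"
proof (rule tendsto_sandwich)
  have "(\<lambda>N. 1 - 2 * (real (q N) / real N)) \<longlonglongrightarrow> 1 - 2 * 0"
    by (intro tendsto_diff tendsto_mult tendsto_const q_over_N)
  thus "(\<lambda>N. 1 - 2 * (real (q N) / real N)) \<longlonglongrightarrow> 1" by simp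
  show "eventually (\<lambda>N. 1 - 2 * (real (q N) / real N) \<le> real (q N) * real (H N) / real N) sequentially"
    using ev_qH eventually_gt_at_top[of 0]
  proof eventually_elim
    case (elim N)
    hence "(real N - 2 * real (q N)) / real N \<le> real (q N) * real (H N) / real N"
      by (intro divide_right_mono) auto
    thus ?case using elim by (simp add: diff_divide_distrib)
  qed
  show "eventually (\<lambda>N. real (q N) * real (H N) / real N \<le> 1) sequentially"
    using ev_qH eventually_gt_at_top[of 0]
  proof eventually_elim
    case (elim N)
    hence "q N * H N \<le> N" by linarith
    hence "real (q N) * real (H N) \<le> real N" by (simp flip: of_nat_mult)
    thus ?case using elim by simp
  qed
qed (rule tendsto_const)

text \<open>This is the expected number of primes among the H terms a + q * e when each is prime
  with probability q / (totient q * ln N); its limit is the parameter of the Poisson law.\<close>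

lemma qH_over_tot: "(\<lambda>N. real (q N) * real (H N) / (tot N * L N)) \<longlonglongrightarrow> lam"
proof -
  have "(\<lambda>N. (real (q N) * real (H N) / real N) / (tot N * L N / real N)) \<longlonglongrightarrow> 1 / (1 / lam)"
    by (intro tendsto_divide qH_over_N tot_asymp) (use lam in auto)
  moreover have "eventually (\<lambda>N. (real (q N) * real (H N) / real N) / (tot N * L N / real N) =
      real (q N) * real (H N) / (tot N * L N)) sequentially"
    using eventually_gt_at_top[of 1] by eventually_elim auto
  ultimately show ?thesis by (rule tendsto_cong_limit) (use lam in simp)
qed

text \<open>q lies between a constant times N / ln N and N. So ln q and ln N are interchangeable as
  normalisations, of which the upper moment bound uses the first and the lower one the
  second.\<close>

lemma ln_q_over_L: "(\<lambda>N. ln (real (q N)) / L N) \<longlonglongrightarrow> 1"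
proof (rule tendsto_sandwich)
  show "(\<lambda>N. ln (real N / (2 * lam * L N)) / L N) \<longlonglongrightarrow> 1" using lam by real_asymp
  show "eventually (\<lambda>N. ln (real N / (2 * lam * L N)) / L N \<le> ln (real (q N)) / L N) sequentially"
    using ev_tot_bounds eventually_gt_at_top[of 1]
  proof eventually_elim
    case (elim N)
    have "real N / (2 * lam * L N) \<le> real (q N)" using elim totient_le[of "q N"] by linarith
    moreover have "0 < real N / (2 * lam * L N)" using elim lam by auto
    ultimately have "ln (real N / (2 * lam * L N)) \<le> ln (real (q N))" by (intro ln_mono)
    thus ?case using elim by (intro divide_right_mono) auto
  qed
  show "eventually (\<lambda>N. ln (real (q N)) / L N \<le> 1) sequentially"
    using ev_qH ev_div_ge[of 1]
  proof eventually_elim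
    case (elim N)
    hence "q N \<le> N" "q N > 0" by linarith+
    hence "ln (real (q N)) \<le> L N" by (intro ln_mono) linarith+
    thus ?case using elim by simp
  qed
qed (rule tendsto_const)

lemma qH_over_tot_ln_q: "(\<lambda>N. real (q N) * real (H N) / (tot N * ln (real (q N)))) \<longlonglongrightarrow> lam"
proof -
  have "(\<lambda>N. (real (q N) * real (H N) / (tot N * L N)) / (ln (real (q N)) / L N)) \<longlonglongrightarrow> lam / 1"
    by (intro tendsto_divide qH_over_tot ln_q_over_L) auto
  moreover have "eventually (\<lambda>N. (real (q N) * real (H N) / (tot N * L N)) / (ln (real (q N)) / L N) =
      real (q N) * real (H N) / (tot N * ln (real (q N)))) sequentially"
    using eventually_gt_at_top[of 1] by eventually_elim auto
  ultimately show ?thesis by (rule tendsto_cong_limit) (use lam in simp)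
qed

lemma over_tot_tendsto_0:
  assumes "(\<lambda>N. f N * L N / real N) \<longlonglongrightarrow> 0"
  shows "(\<lambda>N. f N / tot N) \<longlonglongrightarrow> 0"
proof -
  have "(\<lambda>N. (f N * L N / real N) / (tot N * L N / real N)) \<longlonglongrightarrow> 0 / (1 / lam)"
    by (intro tendsto_divide assms tot_asymp) (use lam in auto)
  moreover have "eventually (\<lambda>N. (f N * L N / real N) / (tot N * L N / real N) = f N / tot N) sequentially"
    using eventually_gt_at_top[of 1] by eventually_elim auto
  ultimately show ?thesis by (rule tendsto_cong_limit) (use lam in simp)
qed

text \<open>The conjecture is applied with a constant multiple \<open>K * N\<close> in place of \<open>N\<close>, since
  \<open>totient (q N) \<le> N / ln N\<close> fails when \<open>lam < 1\<close>.\<close>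
lemma ev_totient_admissible:
  obtains K where "K \<ge> 1"
    and "eventually (\<lambda>N. tot N \<le> real (K * N) / ln (real (K * N))) sequentially"
proof -
  \<comment> \<open>Eventually tot N \<le> 2 * N / (lam * ln N), and ln (K * N) \<le> 2 * ln N once
    K \<le> N; the two factors 2 give 4 / lam.\<close>
  define K where "K = nat \<lceil>4 / lam\<rceil>"
  have K: "real K \<ge> 4 / lam" unfolding K_def by linarith
  moreover have "4 / lam > 0" using lam by simp
  ultimately have "real K > 0" by linarith
  hence K1: "K \<ge> 1" by simp
  have "eventually (\<lambda>N. tot N \<le> real (K * N) / ln (real (K * N))) sequentially"
    using ev_tot_bounds eventually_ge_at_top[of K] eventually_gt_at_top[of 1]
  proof eventually_elim
    case (elim N)
    have LN: "L N > 0" using elim by simp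
    have lnK: "ln (real (K * N)) = ln (real K) + L N"
      using K1 elim by (simp add: ln_mult)
    have "ln (real K) \<le> L N" using K1 elim by (intro ln_mono) auto
    hence le: "ln (real (K * N)) \<le> 2 * L N" "ln (real (K * N)) > 0" using lnK LN K1 by (auto intro: add_nonneg_pos)
    have "tot N \<le> 2 * real N / (lam * L N)" using elim by simp
    also have "\<dots> = (4 / lam) * real N / (2 * L N)" using lam LN by (simp add: field_simps)
    also have "\<dots> \<le> real K * real N / (2 * L N)" using K LN by (intro divide_right_mono mult_right_mono) auto
    also have "\<dots> \<le> real K * real N / ln (real (K * N))" using le LN by (intro divide_left_mono mult_pos_pos) auto
    finally show ?case by simp
  qed
  thus ?thesis using that K1 by blast
qed

text \<open>Each term of \<open>factorial_moment_bounds\<close> is rewritten with the m-th power of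
  q * H / (tot * l), where l is ln q or ln N; this tends to lam ^ m. The errors fit the same
  pattern: tot \<le> q gives H \<le> q * H / tot, so a factor H ^ m costs no more than a power of ln
  N.\<close>

lemma factorial_moment_limit:
  assumes HL: "uniform_hardy_littlewood"
  shows "(\<lambda>N. (\<Sum>a\<in>totatives (q N). real (prime_hits (q N) (H N) a choose m)) / tot N)
    \<longlonglongrightarrow> lam ^ m / fact m"
proof (cases "m = 0")
  \<comment> \<open>The conjecture speaks of nonempty sets of shifts, so m = 0 is treated apart; the
    moment is then 1.\<close>
  case True
  have "eventually (\<lambda>N. (\<Sum>a\<in>totatives (q N). real (prime_hits (q N) (H N) a choose m)) / tot N = 1) sequentially"
    using ev_div_ge[of 0] by eventually_elim (use True in \<open>simp add: totient_def\<close>)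
  thus ?thesis using True by (simp add: tendsto_eventually)
next
  case False
  let ?M = "\<lambda>N. (\<Sum>a\<in>totatives (q N). real (prime_hits (q N) (H N) a choose m)) / tot N"
  let ?G = "\<lambda>N. gallagher_sum m (H N) (q N) / real (H N) ^ m"
  let ?PP = "\<lambda>N. real (card {x. x \<le> N \<and> proper_primepow x})"
  obtain \<delta> C where \<delta>: "\<delta> > 0" and C: "C \<ge> 0" "\<forall>q\<ge>1. \<forall>N\<ge>q. \<forall>E. real (totient q) \<le> real N / ln (real N) \<longrightarrow>
      E \<subseteq> {1..} \<longrightarrow> (\<forall>e\<in>E. q * e \<le> N) \<longrightarrow> card E = m \<longrightarrow>
      \<bar>(\<Sum>n\<in>totatives q. \<Prod>e\<in>E. mangoldt (n + q * e)) -
        (real q / real (totient q)) ^ m * sing_prod E q * real (totient q)\<bar> \<le> C * real N powr (1 - \<delta>)"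
  proof (rule uniform_hardy_littlewood_consequences[OF HL], goal_cases)
    case (1 \<delta>)
    have "m \<ge> 1" using False by simp
    from 1(3)[OF this] show ?case by (elim exE conjE) (rule 1(1)[OF 1(2)], assumption+)
  qed
  obtain K where K: "K \<ge> 1" "eventually (\<lambda>N. tot N \<le> real (K * N) / ln (real (K * N))) sequentially"
    by (rule ev_totient_admissible)
  define R where "R = (\<lambda>N. C * real (K * N) powr (1 - \<delta>))"
  have R: "(\<lambda>N. R N / tot N) \<longlonglongrightarrow> 0"
  proof (rule over_tot_tendsto_0)
    have "(\<lambda>N. C * real K powr (1 - \<delta>) * (real N powr (1 - \<delta>) * L N / real N)) \<longlonglongrightarrow> C * real K powr (1 - \<delta>) * 0"
      by (intro tendsto_mult tendsto_const) (use \<delta> in real_asymp)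
    thus "(\<lambda>N. R N * L N / real N) \<longlonglongrightarrow> 0"
      unfolding R_def by (simp add: powr_mult mult_ac)
  qed
  have PP: "(\<lambda>N. L N ^ m * real m * ?PP N / tot N) \<longlonglongrightarrow> 0"
  proof (rule over_tot_tendsto_0, rule tendsto_sandwich[of "\<lambda>_. 0"])
    \<comment> \<open>The exponent m + 2 collects m logarithms from the weight, one from
      \<open>card_proper_primepow_le\<close> and one from \<open>over_tot_tendsto_0\<close>.\<close>
    have "(\<lambda>N. 2 * real m * (L N powr (real m + 2) * real N powr (-1/2))) \<longlonglongrightarrow> 2 * real m * 0"
      by (intro tendsto_mult tendsto_const) real_asymp
    thus "(\<lambda>N. 2 * real m * (L N powr (real m + 2) * real N powr (-1/2))) \<longlonglongrightarrow> 0" by simp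
    show "eventually (\<lambda>N. L N ^ m * real m * ?PP N * L N / real N \<le> 2 * real m * (L N powr (real m + 2) * real N powr (-1/2))) sequentially"
      using eventually_gt_at_top[of 1]
    proof eventually_elim
      case (elim N)
      have LN: "L N > 0" using elim by simp
      have "L N ^ m * real m * ?PP N * L N / real N \<le> L N ^ m * real m * (sqrt (real N) * (2 * L N)) * L N / real N"
        using elim LN by (intro divide_right_mono mult_right_mono mult_left_mono card_proper_primepow_le) auto
      also have "\<dots> = 2 * real m * (L N ^ m * L N * L N) * (sqrt (real N) / real N)" by simp
      also have "L N ^ m * L N * L N = L N powr (real m + 2)"
        using LN by (simp add: powr_add powr_realpow power2_eq_square)
      also have "sqrt (real N) / real N = real N powr (-1/2)"
        using elim by (simp add: powr_half_sqrt [symmetric] powr_minus powr_diff [symmetric] powr_mult_base divide_simps flip: powr_add)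
      finally show ?case by (simp add: mult_ac)
    qed
    show "eventually (\<lambda>N. 0 \<le> L N ^ m * real m * ?PP N * L N / real N) sequentially"
      using eventually_gt_at_top[of 1] by eventually_elim auto
  qed auto
  have ev: "eventually (\<lambda>N.
      ?M N \<le> (real (q N) * real (H N) / (tot N * ln (real (q N)))) ^ m * ?G N +
        (real (q N) * real (H N) / (tot N * ln (real (q N)))) ^ m * (R N / tot N) \<and>
      (real (q N) * real (H N) / (tot N * L N)) ^ m * ?G N -
        (real (q N) * real (H N) / (tot N * L N)) ^ m * (R N / tot N) -
        (real (q N) * real (H N) / (tot N * L N)) ^ m * (L N ^ m * real m * ?PP N / tot N) \<le> ?M N) sequentially"
    using K(2) ev_qH ev_div_ge[of 2]
  proof eventually_elim
    case (elim N)
    have qH: "q N + q N * H N \<le> N" and q: "q N \<ge> 2" and H: "H N > 0" and N: "N \<ge> 2"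
      using elim by (auto simp: H_def)
    have R0: "R N \<ge> 0" unfolding R_def using C by simp
    have lq: "ln (real (q N)) > 0" and LN: "L N > 0" and t: "tot N > 0" and tq: "tot N \<le> real (q N)"
      using q N totient_le[of "q N"] by auto
    have bound: "\<bar>(\<Sum>n\<in>totatives (q N). \<Prod>e\<in>E. mangoldt (n + q N * e)) -
        (real (q N) / tot N) ^ m * sing_prod E (q N) * tot N\<bar> \<le> R N"
      if E: "E \<subseteq> {1..H N}" "card E = m" for E
    proof -
      have "N \<le> K * N" using K by simp
      have "\<forall>e\<in>E. q N * e \<le> K * N"
      proof
        fix e assume "e \<in> E"
        hence "q N * e \<le> q N * H N" using E by (intro mult_left_mono) auto
        thus "q N * e \<le> K * N" using qH \<open>N \<le> K * N\<close> by linarith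
      qed
      moreover have "q N \<le> K * N" using qH \<open>N \<le> K * N\<close> by linarith
      ultimately show ?thesis using C(2)[rule_format, of "q N" "K * N" E] E elim(1) q unfolding R_def by force
    qed
    note B = factorial_moment_bounds[OF q qH R0 bound]
    have le: "(real (H N) / l) ^ m * R N / tot N \<le>
        (real (q N) * real (H N) / (tot N * l)) ^ m * (R N / tot N)" if "l > 0" for l
    proof -
      have "real (H N) / l * 1 \<le> real (H N) / l * (real (q N) / tot N)"
        using tq t that by (intro mult_left_mono) auto
      hence "real (H N) / l \<le> real (q N) * real (H N) / (tot N * l)" by (simp add: mult.commute)
      hence "(real (H N) / l) ^ m * (R N / tot N) \<le> (real (q N) * real (H N) / (tot N * l)) ^ m * (R N / tot N)"
        using R0 t that by (intro mult_right_mono power_mono) auto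
      thus ?thesis by simp
    qed
    have G: "(real (q N) / (tot N * l)) ^ m * gallagher_sum m (H N) (q N) =
        (real (q N) * real (H N) / (tot N * l)) ^ m * ?G N" for l
      using H by (simp add: power_divide power_mult_distrib)
    have "real (H N) \<le> real (q N) * real (H N) / (tot N * L N) * L N"
    proof -
      have "real (H N) * 1 \<le> real (H N) * (real (q N) / tot N)"
        using tq t by (intro mult_left_mono) auto
      thus ?thesis using LN by (simp add: mult.commute)
    qed
    hence "real (H N) ^ m \<le> (real (q N) * real (H N) / (tot N * L N)) ^ m * L N ^ m"
      unfolding power_mult_distrib [symmetric] by (intro power_mono) auto
    hence "real (H N) ^ m * (real m * ?PP N / tot N) \<le>
        (real (q N) * real (H N) / (tot N * L N)) ^ m * L N ^ m * (real m * ?PP N / tot N)"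
      by (intro mult_right_mono) auto
    hence P: "real (H N) ^ m * real m * ?PP N / tot N \<le>
        (real (q N) * real (H N) / (tot N * L N)) ^ m * (L N ^ m * real m * ?PP N / tot N)"
      by (simp add: mult.assoc)
    show ?case
      using B(1)[unfolded G] B(2)[unfolded G] le[OF lq] le[OF LN] P by linarith
  qed
  show ?thesis
  proof (rule tendsto_sandwich)
    show "eventually (\<lambda>N. ?M N \<le> (real (q N) * real (H N) / (tot N * ln (real (q N)))) ^ m * ?G N +
        (real (q N) * real (H N) / (tot N * ln (real (q N)))) ^ m * (R N / tot N)) sequentially"
      using ev by eventually_elim auto
    show "eventually (\<lambda>N. (real (q N) * real (H N) / (tot N * L N)) ^ m * ?G N -
        (real (q N) * real (H N) / (tot N * L N)) ^ m * (R N / tot N) -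
        (real (q N) * real (H N) / (tot N * L N)) ^ m * (L N ^ m * real m * ?PP N / tot N) \<le> ?M N) sequentially"
      using ev by eventually_elim auto
    have "(\<lambda>N. (real (q N) * real (H N) / (tot N * ln (real (q N)))) ^ m * ?G N +
        (real (q N) * real (H N) / (tot N * ln (real (q N)))) ^ m * (R N / tot N))
        \<longlonglongrightarrow> lam ^ m * (1 / fact m) + lam ^ m * 0"
      by (intro tendsto_add tendsto_mult tendsto_power qH_over_tot_ln_q gallagher_asymp H_at_top R)
    thus "(\<lambda>N. (real (q N) * real (H N) / (tot N * ln (real (q N)))) ^ m * ?G N +
        (real (q N) * real (H N) / (tot N * ln (real (q N)))) ^ m * (R N / tot N))
        \<longlonglongrightarrow> lam ^ m / fact m" by simp
    have "(\<lambda>N. (real (q N) * real (H N) / (tot N * L N)) ^ m * ?G N -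
        (real (q N) * real (H N) / (tot N * L N)) ^ m * (R N / tot N) -
        (real (q N) * real (H N) / (tot N * L N)) ^ m * (L N ^ m * real m * ?PP N / tot N))
        \<longlonglongrightarrow> lam ^ m * (1 / fact m) - lam ^ m * 0 - lam ^ m * 0"
      by (intro tendsto_diff tendsto_mult tendsto_power qH_over_tot gallagher_asymp H_at_top R PP)
    thus "(\<lambda>N. (real (q N) * real (H N) / (tot N * L N)) ^ m * ?G N -
        (real (q N) * real (H N) / (tot N * L N)) ^ m * (R N / tot N) -
        (real (q N) * real (H N) / (tot N * L N)) ^ m * (L N ^ m * real m * ?PP N / tot N))
        \<longlonglongrightarrow> lam ^ m / fact m" by simp
  qed
qed

text \<open>The trivial bound q is useless, being at least totient q. At most sqrt N of the primes
  are \<le> sqrt N; every other one has von Mangoldt value at least half of ln N, and the conjecture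
  with modulus 1 bounds the sum of these values by q plus a power-saving error. This leaves a
  multiple of q / ln N, which \<open>q_over_tot\<close> makes negligible against totient q.\<close>

lemma short_interval_primes_negligible:
  assumes HL: "uniform_hardy_littlewood" and d: "eventually (\<lambda>N. d N \<in> {1..N}) sequentially"
  shows "(\<lambda>N. real (card {n\<in>{1..q N}. prime (n + d N)}) / tot N) \<longlonglongrightarrow> 0"
proof -
  obtain \<delta> C where \<delta>: "\<delta> > 0" and C: "C \<ge> 0" "\<forall>N. \<forall>x\<in>{1..N}. \<forall>d\<in>{1..N}. 1 \<le> real N / ln (real N) \<longrightarrow>
      \<bar>(\<Sum>n\<in>{1..x}. mangoldt (n + d)) - real x\<bar> \<le> C * real N powr (1 - \<delta>)"
  proof (rule uniform_hardy_littlewood_consequences[OF HL], goal_cases)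
    case (1 \<delta>)
    from 1(4) show ?case by (elim exE conjE) (rule 1(1)[OF 1(2)], assumption+)
  qed
  let ?R = "\<lambda>N. C * real N powr (1 - \<delta>)"
  let ?up = "\<lambda>N. sqrt (real N) / tot N + 2 * (real (q N) / (tot N * L N)) + 2 * ((?R N / L N) / tot N)"
  have "eventually (\<lambda>N. 1 \<le> real N / ln (real N)) sequentially" by real_asymp
  hence ev: "eventually (\<lambda>N. real (card {n\<in>{1..q N}. prime (n + d N)}) / tot N \<le> ?up N) sequentially"
    using d ev_qH ev_div_ge[of 1]
  proof eventually_elim
    case (elim N)
    have q: "q N \<in> {1..N}" and N: "N \<ge> 2" and t: "tot N > 0" using elim by auto
    have LN: "L N > 0" using N by simp
    let ?A = "{n\<in>{1..q N}. prime (n + d N)}"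
    let ?B = "{n\<in>?A. real (n + d N) > sqrt (real N)}"
    have "inj_on (\<lambda>n. n + d N) (?A - ?B)" by simp
    moreover have "(\<lambda>n. n + d N) ` (?A - ?B) \<subseteq> {1..nat \<lfloor>sqrt (real N)\<rfloor>}"
      by (auto intro!: le_nat_floor)
    ultimately have "card (?A - ?B) \<le> card {1..nat \<lfloor>sqrt (real N)\<rfloor>}"
      by (rule card_inj_on_le) simp
    hence "real (card (?A - ?B)) \<le> real (nat \<lfloor>sqrt (real N)\<rfloor>)" by (simp only: card_atLeastAtMost)
    also have "\<dots> \<le> sqrt (real N)" by simp
    finally have small: "real (card (?A - ?B)) \<le> sqrt (real N)" .
    have "real (card ?B) * (L N / 2) = (\<Sum>n\<in>?B. L N / 2)" by simp
    also have "\<dots> \<le> (\<Sum>n\<in>?B. mangoldt (n + d N))"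
    proof (rule sum_mono)
      fix n assume n: "n \<in> ?B"
      have "L N / 2 = ln (sqrt (real N))" using N by (simp add: ln_sqrt)
      also have "\<dots> \<le> ln (real (n + d N))" using n N by (intro ln_mono) auto
      also have "\<dots> = mangoldt (n + d N)" using n by (simp del: of_nat_add)
      finally show "L N / 2 \<le> mangoldt (n + d N)" .
    qed
    also have "\<dots> \<le> (\<Sum>n\<in>{1..q N}. mangoldt (n + d N))"
      by (rule sum_mono2) (auto intro: mangoldt_nonneg)
    also have "\<dots> \<le> real (q N) + ?R N"
    proof -
      have "\<bar>(\<Sum>n\<in>{1..q N}. mangoldt (n + d N)) - real (q N)\<bar> \<le> ?R N" using C(2) q elim(1,2) by blast
      thus ?thesis by linarith
    qed
    finally have "real (card ?B) \<le> 2 * (real (q N) + ?R N) / L N"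
      using LN by (simp add: pos_le_divide_eq)
    moreover have "card ?A = card (?A - ?B) + card ?B"
      by (subst card_Un_disjoint [symmetric]) (auto intro: arg_cong[where f = card])
    ultimately have "real (card ?A) \<le> sqrt (real N) + 2 * (real (q N) + ?R N) / L N"
      using small by linarith
    hence "real (card ?A) / tot N \<le> (sqrt (real N) + 2 * (real (q N) + ?R N) / L N) / tot N"
      using t by (intro divide_right_mono) auto
    thus ?case by (simp add: add_divide_distrib distrib_left mult.commute)
  qed
  have "(\<lambda>N. sqrt (real N) / tot N) \<longlonglongrightarrow> 0"
    by (rule over_tot_tendsto_0) real_asymp
  moreover have "(\<lambda>N. (?R N / L N) / tot N) \<longlonglongrightarrow> 0"
  proof (rule over_tot_tendsto_0)
    have "(\<lambda>N. C * (real N powr (1 - \<delta>) / L N * L N / real N)) \<longlonglongrightarrow> C * 0"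
      by (intro tendsto_mult tendsto_const) (use \<delta> in real_asymp)
    moreover have "C * (a / l * l / n) = C * a / l * l / n" for a l n :: real by simp
    ultimately show "(\<lambda>N. ?R N / L N * L N / real N) \<longlonglongrightarrow> 0" by (simp only: mult_zero_right)
  qed
  ultimately have "?up \<longlonglongrightarrow> 0 + 2 * 0 + 2 * 0"
    by (intro tendsto_add tendsto_mult tendsto_const q_over_tot)
  hence up: "?up \<longlonglongrightarrow> 0" by simp
  show ?thesis
    by (rule tendsto_sandwich[OF _ ev tendsto_const up]) simp
qed

text \<open>A prime p \<le> N in the class of a is a + q * e with e \<le> N div q. Of these indices
  \<open>prime_hits\<close> misses just e = 0 and e = N div q, the two cases excluded by the last
  assumptions.\<close>

lemma primes_in_ap_eq_prime_hits:
  assumes q: "q N \<ge> 2" and N: "N div q N \<ge> 1" and a: "a \<in> totatives (q N)"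
    and "\<not> prime a" "\<not> prime (a + q N * (N div q N))"
  shows "primes_in_ap N (q N) a = prime_hits (q N) (H N) a"
proof -
  have a': "a < q N" using totatives_less[OF a] q by simp
  obtain M where M: "N div q N = Suc M" using N by (cases "N div q N") auto
  have H: "H N = M" unfolding H_def M by simp
  have N: "q N * Suc M + N mod q N = N" using mult_div_mod_eq[of "q N" N] unfolding M .
  have N': "N mod q N < q N" using q by simp
  have "{p. prime p \<and> p \<le> N \<and> [p = a] (mod q N)} = (\<lambda>e. a + q N * e) ` {e\<in>{1..H N}. prime (a + q N * e)}"
  proof (intro equalityI subsetI)
    fix p assume "p \<in> {p. prime p \<and> p \<le> N \<and> [p = a] (mod q N)}"
    hence p: "prime p" "p \<le> N" "p mod q N = a"
      using a' by (auto simp: unique_euclidean_semiring_class.cong_def)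
    define e where "e = p div q N"
    have pe: "p = a + q N * e" using mod_mult_div_eq[of p "q N"] p(3) unfolding e_def by simp
    have "e \<le> N div q N" unfolding e_def using p(2) by (rule div_le_mono)
    moreover have "e \<noteq> Suc M" using assms(5) p(1) pe M by auto
    ultimately have "e \<le> H N" unfolding H M by simp
    moreover have "e \<noteq> 0" using assms(4) p(1) pe by (intro notI) simp
    ultimately show "p \<in> (\<lambda>e. a + q N * e) ` {e\<in>{1..H N}. prime (a + q N * e)}"
      using p(1) pe by auto
  next
    fix p assume "p \<in> (\<lambda>e. a + q N * e) ` {e\<in>{1..H N}. prime (a + q N * e)}"
    then obtain e where e: "e \<le> M" "prime (a + q N * e)" "p = a + q N * e" unfolding H by auto
    have "q N * e \<le> q N * M" using e(1) by (rule mult_left_mono) simp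
    hence "p \<le> N" using N a' e(3) unfolding mult_Suc_right by linarith
    thus "p \<in> {p. prime p \<and> p \<le> N \<and> [p = a] (mod q N)}"
      using e by (simp add: unique_euclidean_semiring_class.cong_def)
  qed
  moreover have "inj_on (\<lambda>e. a + q N * e) {e\<in>{1..H N}. prime (a + q N * e)}"
    using q by (auto simp: inj_on_def)
  ultimately show ?thesis
    unfolding primes_in_ap_def prime_hits_def by (simp add: card_image)
qed

lemma ap_count_minus_hits_negligible:
  assumes HL: "uniform_hardy_littlewood"
  shows "(\<lambda>N. (real (card {a\<in>{0..<q N}. coprime a (q N) \<and> primes_in_ap N (q N) a = k}) -
      real (card {a\<in>totatives (q N). prime_hits (q N) (H N) a = k})) / tot N) \<longlonglongrightarrow> 0"
proof (rule tendsto_rabs_zero_cancel, rule tendsto_sandwich[of "\<lambda>_. 0"])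
  \<comment> \<open>The shift in \<open>short_interval_primes_negligible\<close> must be at least 1,
    so a prime a is written as (a - 1) + 1.\<close>
  let ?X = "\<lambda>N. {n\<in>{1..q N}. prime (n + 1)}" and ?Y = "\<lambda>N. {n\<in>{1..q N}. prime (n + q N * (N div q N))}"
  show "eventually (\<lambda>N. \<bar>(real (card {a\<in>{0..<q N}. coprime a (q N) \<and> primes_in_ap N (q N) a = k}) -
      real (card {a\<in>totatives (q N). prime_hits (q N) (H N) a = k})) / tot N\<bar> \<le>
      real (card (?X N)) / tot N + real (card (?Y N)) / tot N) sequentially"
    using ev_div_ge[of 1]
  proof eventually_elim
    case (elim N)
    let ?P = "{a\<in>{0..<q N}. coprime a (q N) \<and> primes_in_ap N (q N) a = k}"
    let ?Q = "{a\<in>totatives (q N). prime_hits (q N) (H N) a = k}"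
    define Z where "Z = (\<lambda>n. n + 1) ` ?X N \<union> ?Y N"
    \<comment> \<open>The two systems of representatives differ only in 0 and q, neither of which is
      coprime to q since q \<ge> 2.\<close>
    have "{a\<in>{0..<q N}. coprime a (q N)} = totatives (q N)"
      using elim totatives_less[of _ "q N"] by (auto simp: totatives_def intro!: Nat.gr0I)
    hence P: "?P = {a\<in>totatives (q N). primes_in_ap N (q N) a = k}" by blast
    have Z: "a \<in> Z" if "a \<in> totatives (q N)" "primes_in_ap N (q N) a \<noteq> prime_hits (q N) (H N) a" for a
    proof -
      have a: "a \<in> {1..q N}" using that(1) by (auto simp: totatives_def)
      have "prime a \<or> prime (a + q N * (N div q N))"
        using primes_in_ap_eq_prime_hits[of N a] that elim by blast
      thus ?thesis
      proof
        assume "prime a"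
        hence "a - 1 \<in> ?X N" "a = a - 1 + 1" using a prime_ge_2_nat[of a] by auto
        thus ?thesis unfolding Z_def by blast
      qed (use a in \<open>auto simp: Z_def\<close>)
    qed
    have fin: "finite (?P \<union> Z)" "finite (?Q \<union> Z)" unfolding Z_def by auto
    have "card (?P \<union> Z) \<le> card ?P + card Z" "card (?Q \<union> Z) \<le> card ?Q + card Z" by (rule card_Un_le)+
    moreover have "?Q \<subseteq> ?P \<union> Z" "?P \<subseteq> ?Q \<union> Z"
    proof -
      have "a \<in> Z \<or> primes_in_ap N (q N) a = prime_hits (q N) (H N) a" if "a \<in> totatives (q N)" for a
        using Z that by blast
      thus "?Q \<subseteq> ?P \<union> Z" "?P \<subseteq> ?Q \<union> Z" unfolding P by force+
    qed
    hence "card ?Q \<le> card (?P \<union> Z)" "card ?P \<le> card (?Q \<union> Z)"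
      using fin by (simp_all only: card_mono)
    moreover have "card Z \<le> card (?X N) + card (?Y N)"
      using card_Un_le[of "(\<lambda>n. n + 1) ` ?X N" "?Y N"] card_image_le[of "?X N" "\<lambda>n. n + 1"] by (simp add: Z_def)
    ultimately have "\<bar>real (card ?P) - real (card ?Q)\<bar> \<le> real (card (?X N)) + real (card (?Y N))"
      by linarith
    hence "\<bar>real (card ?P) - real (card ?Q)\<bar> / tot N \<le> (real (card (?X N)) + real (card (?Y N))) / tot N"
      by (rule divide_right_mono) simp
    thus ?case by (simp add: add_divide_distrib)
  qed
  have "eventually (\<lambda>N. 1 \<in> {1..N}) sequentially"
    using eventually_ge_at_top[of 1] by eventually_elim auto
  moreover have "eventually (\<lambda>N. q N * (N div q N) \<in> {1..N}) sequentially"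
    using ev_div_ge[of 1] by eventually_elim (auto simp: Suc_le_eq)
  ultimately have "(\<lambda>N. real (card (?X N)) / tot N + real (card (?Y N)) / tot N) \<longlonglongrightarrow> 0 + 0"
    by (intro tendsto_add short_interval_primes_negligible[OF HL])
  thus "(\<lambda>N. real (card (?X N)) / tot N + real (card (?Y N)) / tot N) \<longlonglongrightarrow> 0" by simp
qed auto

text \<open>\<open>binomial_inversion_bound\<close> is averaged over a at truncation level J. The
  truncated sums converge to lam ^ k / k! times a partial sum of the series of exp (- lam), with an
  error given by the next term of that series. This direct inversion bypasses the question whether
  the moments determine the limit law.\<close>

lemma hits_distribution_limit:
  assumes HL: "uniform_hardy_littlewood"
  shows "(\<lambda>N. real (card {a\<in>totatives (q N). prime_hits (q N) (H N) a = k}) / tot N)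
    \<longlonglongrightarrow> exp (- lam) * (lam ^ k / fact k)"
proof (rule tendsto_approximation)
  let ?M = "\<lambda>m N. (\<Sum>a\<in>totatives (q N). real (prime_hits (q N) (H N) a choose m)) / tot N"
  let ?b = "\<lambda>J. lam ^ k / fact k * (\<Sum>j\<le>J. (- lam) ^ j / fact j)"
  let ?e = "\<lambda>J. lam ^ k / fact k * (lam ^ Suc J / fact (Suc J))"
  have coeff: "real (k + j choose k) * (lam ^ (k + j) / fact (k + j)) = lam ^ k / fact k * (lam ^ j / fact j)" for j
    by (simp add: binomial_fact power_add)
  show "(\<lambda>N. \<Sum>j\<le>J. (-1) ^ j * real (k + j choose k) * ?M (k + j) N) \<longlonglongrightarrow> ?b J" for J
  proof -
    have "(\<lambda>N. \<Sum>j\<le>J. (-1) ^ j * real (k + j choose k) * ?M (k + j) N) \<longlonglongrightarrow>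
      (\<Sum>j\<le>J. (-1) ^ j * real (k + j choose k) * (lam ^ (k + j) / fact (k + j)))"
      by (intro tendsto_sum tendsto_mult tendsto_const factorial_moment_limit HL)
    also have "(\<Sum>j\<le>J. (-1) ^ j * real (k + j choose k) * (lam ^ (k + j) / fact (k + j))) = ?b J"
      unfolding mult.assoc coeff by (simp add: sum_distrib_left power_minus[of lam] mult_ac)
    finally show ?thesis .
  qed
  show "(\<lambda>N. real (k + Suc J choose k) * ?M (k + Suc J) N) \<longlonglongrightarrow> ?e J" for J
  proof -
    have "(\<lambda>N. real (k + Suc J choose k) * ?M (k + Suc J) N) \<longlonglongrightarrow>
        real (k + Suc J choose k) * (lam ^ (k + Suc J) / fact (k + Suc J))"
      by (intro tendsto_mult tendsto_const factorial_moment_limit HL)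
    thus ?thesis unfolding coeff .
  qed
  show "eventually (\<lambda>N. \<bar>real (card {a\<in>totatives (q N). prime_hits (q N) (H N) a = k}) / tot N -
      (\<Sum>j\<le>J. (-1) ^ j * real (k + j choose k) * ?M (k + j) N)\<bar> \<le>
      real (k + Suc J choose k) * ?M (k + Suc J) N) sequentially" for J
  proof (intro always_eventually allI)
    fix N
    let ?X = "\<lambda>a. prime_hits (q N) (H N) a"
    have "real (card {a\<in>totatives (q N). ?X a = k}) = (\<Sum>a\<in>totatives (q N). if ?X a = k then 1 else 0)"
      by (simp add: sum.If_cases Int_def)
    moreover have "(\<Sum>j\<le>J. (-1) ^ j * real (k + j choose k) * ?M (k + j) N) =
        (\<Sum>a\<in>totatives (q N). \<Sum>j\<le>J. (-1) ^ j * real (k + j choose k) * real (?X a choose (k + j))) / tot N"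
    proof -
      have "(\<Sum>j\<le>J. (-1) ^ j * real (k + j choose k) * ?M (k + j) N) =
          (\<Sum>j\<le>J. \<Sum>a\<in>totatives (q N). (-1) ^ j * real (k + j choose k) * real (?X a choose (k + j)) / tot N)"
        by (simp only: sum_distrib_left sum_divide_distrib times_divide_eq_right)
      also have "\<dots> = (\<Sum>a\<in>totatives (q N). \<Sum>j\<le>J. (-1) ^ j * real (k + j choose k) * real (?X a choose (k + j)) / tot N)"
        by (rule sum.swap)
      finally show ?thesis by (simp only: sum_divide_distrib)
    qed
    ultimately have eq: "real (card {a\<in>totatives (q N). ?X a = k}) / tot N -
        (\<Sum>j\<le>J. (-1) ^ j * real (k + j choose k) * ?M (k + j) N) =
        (\<Sum>a\<in>totatives (q N). (if ?X a = k then 1 else 0) -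
          (\<Sum>j\<le>J. (-1) ^ j * real (k + j choose k) * real (?X a choose (k + j)))) / tot N"
      by (simp add: sum_subtractf diff_divide_distrib)
    have "\<bar>(\<Sum>a\<in>totatives (q N). (if ?X a = k then 1 else 0) -
          (\<Sum>j\<le>J. (-1) ^ j * real (k + j choose k) * real (?X a choose (k + j)))) / tot N\<bar> \<le>
        (\<Sum>a\<in>totatives (q N). real (k + Suc J choose k) * real (?X a choose (k + Suc J))) / tot N"
      unfolding abs_divide abs_of_nat
      by (intro divide_right_mono order.trans[OF sum_abs] sum_mono binomial_inversion_bound) auto
    also have "\<dots> = real (k + Suc J choose k) * ?M (k + Suc J) N"
      by (simp only: sum_distrib_left times_divide_eq_right)
    finally show "\<bar>real (card {a\<in>totatives (q N). ?X a = k}) / tot N -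
      (\<Sum>j\<le>J. (-1) ^ j * real (k + j choose k) * ?M (k + j) N)\<bar> \<le>
      real (k + Suc J choose k) * ?M (k + Suc J) N" unfolding eq .
  qed
  have exp: "(\<lambda>j. (- lam) ^ j / fact j) sums exp (- lam)" "summable (\<lambda>j. lam ^ j / fact j)"
    using exp_converges[of "- lam"] summable_exp[of lam] by (simp_all add: field_simps)
  have "(\<lambda>J. \<Sum>j\<le>J. (- lam) ^ j / fact j) \<longlonglongrightarrow> exp (- lam)"
    using exp(1) by (simp add: sums_def_le)
  hence "?b \<longlonglongrightarrow> lam ^ k / fact k * exp (- lam)"
    by (intro tendsto_mult tendsto_const)
  thus "?b \<longlonglongrightarrow> exp (- lam) * (lam ^ k / fact k)" by (simp only: mult.commute)
  have "(\<lambda>J. lam ^ Suc J / fact (Suc J)) \<longlonglongrightarrow> 0"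
    using LIMSEQ_Suc[OF summable_LIMSEQ_zero[OF exp(2)]] .
  hence "?e \<longlonglongrightarrow> lam ^ k / fact k * 0"
    by (intro tendsto_mult tendsto_const)
  thus "?e \<longlonglongrightarrow> 0" by simp
qed

end

theorem corollary1p2:
  fixes k :: nat and q :: "nat \<Rightarrow> nat" and lam :: real
  assumes "uniform_hardy_littlewood"
    and "lam > 0"
    and "(\<lambda>N. real (totient (q N))) \<sim>[at_top] (\<lambda>N. real N / (lam * ln (real N)))"
  shows "(\<lambda>N. 1 / real (totient (q N)) *
            real (card {a \<in> {0..<q N}. coprime a (q N) \<and> primes_in_ap N (q N) a = k}))
           \<longlonglongrightarrow> exp (- lam) * (lam ^ k / fact k)"
proof -
  interpret critical_modulus q lam by unfold_locales (fact assms)+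
  have "(\<lambda>N. (real (card {a\<in>{0..<q N}. coprime a (q N) \<and> primes_in_ap N (q N) a = k}) -
      real (card {a\<in>totatives (q N). prime_hits (q N) (H N) a = k})) / tot N +
      real (card {a\<in>totatives (q N). prime_hits (q N) (H N) a = k}) / tot N)
      \<longlonglongrightarrow> 0 + exp (- lam) * (lam ^ k / fact k)"
    by (intro tendsto_add ap_count_minus_hits_negligible hits_distribution_limit assms(1))
  thus ?thesis by (simp add: diff_divide_distrib)
qed

end
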